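(* Consider the nonlinear program: minimize $f(x)$ subject to $\varphi_i(x)\le0$ ($i=1,\dots,s$), $\varphi_i(x)=0$ ($i=s+1,\dots,m$), with $f$ and all $\varphi_i$ $\mathcal C^2$-smooth around a feasible $\bar x$ such that $\nabla_xL(\bar x,\bar y)=0$ and $\langle\bar y,g(\bar x)\rangle=0$ for some $\bar y\in\mathbb{R}_+^s\times\mathbb{R}^{m-s}$, and suppose MSCQ holds at $\bar x$. Let $\Phi:=f+\delta_\Gamma$. (i) If there exist neighborhoods $U$ of $\bar x$ and $V$ of $0$ such that $\langle\nabla^2f(x)w,w\rangle+\langle w,\nabla^2\langle y,g\rangle(x)w\rangle\ge0$ for all $x\in U$, $v\in V$, all $y\in\mathbb{R}_+^s\times\mathbb{R}^{m-s}$ with $v=\nabla_xL(x,y)$ and $\langle y,g(x)\rangle=0$, and all $w\in S(x,y)$, then $\Phi$ is variationally convex at $\bar x$ for $0$, and $\bar x$ is a local minimizer. (ii) If there exist $\sigma>0$ and such neighborhoods with $\langle\nabla^2f(x)w,w\rangle+\langle w,\nabla^2\langle y,g\rangle(x)w\rangle\ge\sigma\|w\|^2$ for all such $x,v,y,w$, then $\Phi$ is strongly variationally convex at $\bar x$ for $0$ with modulus $\sigma$, and $\bar x$ is a tilt-stable local minimizer of $\Phi$ with modulus $\sigma^{-1}$ (in particular a strong local minimizer).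
   Context: $g:=(\varphi_1,\dots,\varphi_m)$, $\Gamma$ the feasible set, $\delta_\Gamma$ its indicator; $L(x,y):=f(x)+\langle y,g(x)\rangle$; $I(x):=\{i\le s:\varphi_i(x)=0\}$, $I_+(x,y):=\{i\in I(x):y_i>0\}$, $S(x,y):=\{w:\langle\nabla\varphi_i(x),w\rangle=0\ (i\in\{s+1,\dots,m\}\cup I_+(x,y)),\ \langle\nabla\varphi_i(x),w\rangle\ge0\ (i\in I(x)\setminus I_+(x,y))\}$. MSCQ at $\bar x$: $\operatorname{dist}(x;\Gamma)\le\kappa\big(\sum_{i\le s}\max\{\varphi_i(x),0\}+\sum_{i>s}|\varphi_i(x)|\big)$ for some $\kappa>0$ and all $x$ near $\bar x$. Variational convexity of l.s.c. $\Phi$ at $\bar x$ for $\bar v\in\partial\Phi(\bar x)$ (limiting subdifferential): there exist a convex neighborhood $U\times V$ of $(\bar x,\bar v)$, $\varepsilon>0$, and l.s.c. convex $\psi\le\Phi$ on $U$ with $(U_\varepsilon\times V)\cap\operatorname{gph}\partial\Phi=(U\times V)\cap\operatorname{gph}\partial\psi$ and $\Phi=\psi$ at common elements, $U_\varepsilon:=\{x\in U:\Phi(x)<\Phi(\bar x)+\varepsilon\}$; strong version: $\psi$ strongly convex on $U$ with modulus $\sigma$. Tilt-stable local minimizer: for some $\gamma>0$, $M_\gamma(v):=\operatorname{argmin}\{\Phi(x)-\langle v,x\rangle:\|x-\bar x\|\le\gamma\}$ is single-valued and Lipschitz near $0$ with $M_\gamma(0)=\{\bar x\}$; modulus = a Lipschitz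 constant of $M_\gamma$. *)

theory Defs
  imports "HOL-Analysis.Analysis"
begin

definition grad :: "('a::euclidean_space \<Rightarrow> real) \<Rightarrow> 'a \<Rightarrow> 'a" where
  "grad f x = (THE g. (f has_derivative (\<lambda>h. g \<bullet> h)) (at x))"

definition hess :: "('a::euclidean_space \<Rightarrow> real) \<Rightarrow> 'a \<Rightarrow> 'a \<Rightarrow> 'a" where
  "hess f x w = frechet_derivative (grad f) (at x) w"

definition C2_near :: "('a::euclidean_space \<Rightarrow> real) \<Rightarrow> 'a \<Rightarrow> bool" where
  "C2_near f xb \<longleftrightarrow> (\<exists>N. open N \<and> xb \<in> N \<and>
      (\<forall>x\<in>N. f differentiable (at x)) \<and>
      (\<forall>x\<in>N. grad f differentiable (at x)) \<and>
      (\<forall>h. continuous_on N (\<lambda>x. hess f x h)))"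

definition feas :: "(nat \<Rightarrow> 'a \<Rightarrow> real) \<Rightarrow> nat \<Rightarrow> nat \<Rightarrow> 'a set" where
  "feas \<phi> s m = {x. (\<forall>i\<in>{1..s}. \<phi> i x \<le> 0) \<and> (\<forall>i\<in>{s+1..m}. \<phi> i x = 0)}"

definition ypair :: "(nat \<Rightarrow> 'a \<Rightarrow> real) \<Rightarrow> nat \<Rightarrow> (nat \<Rightarrow> real) \<Rightarrow> 'a \<Rightarrow> real" where
  "ypair \<phi> m y x = (\<Sum>i=1..m. y i * \<phi> i x)"

definition Lag :: "('a \<Rightarrow> real) \<Rightarrow> (nat \<Rightarrow> 'a \<Rightarrow> real) \<Rightarrow> nat \<Rightarrow> 'a \<Rightarrow> (nat \<Rightarrow> real) \<Rightarrow> real" where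
  "Lag f \<phi> m x y = f x + ypair \<phi> m y x"

text \<open>\<open>y \<in> R_+^s \<times> R^(m-s)\<close> (only the components 1..m matter)\<close>
definition mult_cone :: "nat \<Rightarrow> (nat \<Rightarrow> real) set" where
  "mult_cone s = {y. \<forall>i\<in>{1..s}. 0 \<le> y i}"

definition active :: "(nat \<Rightarrow> 'a \<Rightarrow> real) \<Rightarrow> nat \<Rightarrow> 'a \<Rightarrow> nat set" where
  "active \<phi> s x = {i\<in>{1..s}. \<phi> i x = 0}"

definition active_plus :: "(nat \<Rightarrow> 'a \<Rightarrow> real) \<Rightarrow> nat \<Rightarrow> 'a \<Rightarrow> (nat \<Rightarrow> real) \<Rightarrow> nat set" where
  "active_plus \<phi> s x y = {i\<in>active \<phi> s x. 0 < y i}"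

definition Scone :: "(nat \<Rightarrow> 'a::euclidean_space \<Rightarrow> real) \<Rightarrow> nat \<Rightarrow> nat \<Rightarrow> 'a \<Rightarrow> (nat \<Rightarrow> real) \<Rightarrow> 'a set" where
  "Scone \<phi> s m x y = {w.
     (\<forall>i\<in>{s+1..m} \<union> active_plus \<phi> s x y. grad (\<phi> i) x \<bullet> w = 0) \<and>
     (\<forall>i\<in>active \<phi> s x - active_plus \<phi> s x y. grad (\<phi> i) x \<bullet> w \<ge> 0)}"

definition MSCQ :: "(nat \<Rightarrow> 'a::euclidean_space \<Rightarrow> real) \<Rightarrow> nat \<Rightarrow> nat \<Rightarrow> 'a \<Rightarrow> bool" where
  "MSCQ \<phi> s m xb \<longleftrightarrow> (\<exists>\<kappa>>0. \<exists>\<delta>>0. \<forall>x\<in>ball xb \<delta>.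
      infdist x (feas \<phi> s m) \<le>
        \<kappa> * ((\<Sum>i=1..s. max (\<phi> i x) 0) + (\<Sum>i=s+1..m. \<bar>\<phi> i x\<bar>)))"

definition Phi :: "('a \<Rightarrow> real) \<Rightarrow> (nat \<Rightarrow> 'a \<Rightarrow> real) \<Rightarrow> nat \<Rightarrow> nat \<Rightarrow> 'a \<Rightarrow> ereal" where
  "Phi f \<phi> s m x = (if x \<in> feas \<phi> s m then ereal (f x) else \<infinity>)"

text \<open>Regular (Frechet) subdifferential: \<open>liminf_{u\<rightarrow>x} (\<Phi> u - \<Phi> x - \<langle>v,u-x\<rangle>)/\<parallel>u-x\<parallel> \<ge> 0\<close>.\<close>
definition frechet_subdiff :: "('a::euclidean_space \<Rightarrow> ereal) \<Rightarrow> 'a \<Rightarrow> 'a set" where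
  "frechet_subdiff \<Phi> x = {v. \<bar>\<Phi> x\<bar> \<noteq> \<infinity> \<and>
     (\<forall>e>0. \<exists>d>0. \<forall>u\<in>ball x d. \<Phi> x + ereal (v \<bullet> (u - x) - e * norm (u - x)) \<le> \<Phi> u)}"

definition limiting_subdiff :: "('a::euclidean_space \<Rightarrow> ereal) \<Rightarrow> 'a \<Rightarrow> 'a set" where
  "limiting_subdiff \<Phi> x = {v. \<bar>\<Phi> x\<bar> \<noteq> \<infinity> \<and>
     (\<exists>xk vk. xk \<longlonglongrightarrow> x \<and> (\<lambda>k. \<Phi> (xk k)) \<longlonglongrightarrow> \<Phi> x \<and>
        (\<forall>k. vk k \<in> frechet_subdiff \<Phi> (xk k)) \<and> vk \<longlonglongrightarrow> v)}"

definition lsc_on :: "'a::topological_space set \<Rightarrow> ('a \<Rightarrow> ereal) \<Rightarrow> bool" where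
  "lsc_on U \<psi> \<longleftrightarrow> (\<forall>x\<in>U. \<forall>c<\<psi> x. eventually (\<lambda>u. c < \<psi> u) (at x))"

definition ereal_convex_on :: "'a::real_vector set \<Rightarrow> ('a \<Rightarrow> ereal) \<Rightarrow> bool" where
  "ereal_convex_on U \<psi> \<longleftrightarrow> convex U \<and> convex {(x, r::real). x \<in> U \<and> \<psi> x \<le> ereal r}"

definition ereal_strongly_convex_on :: "'a::real_normed_vector set \<Rightarrow> real \<Rightarrow> ('a \<Rightarrow> ereal) \<Rightarrow> bool" where
  "ereal_strongly_convex_on U \<sigma> \<psi> \<longleftrightarrow>
     ereal_convex_on U (\<lambda>x. \<psi> x - ereal (\<sigma> / 2 * (norm x)\<^sup>2))"

definition var_convex_gen ::
  "('a::euclidean_space set \<Rightarrow> ('a \<Rightarrow> ereal) \<Rightarrow> bool) \<Rightarrow> ('a \<Rightarrow> ereal) \<Rightarrow> 'a \<Rightarrow> 'a \<Rightarrow> bool" where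
  "var_convex_gen C \<Phi> xb vb \<longleftrightarrow> vb \<in> limiting_subdiff \<Phi> xb \<and>
     (\<exists>U V \<epsilon> \<psi>. convex U \<and> open U \<and> xb \<in> U \<and> convex V \<and> open V \<and> vb \<in> V \<and> \<epsilon> > 0 \<and>
        lsc_on U \<psi> \<and> C U \<psi> \<and> (\<forall>x\<in>U. \<psi> x \<le> \<Phi> x) \<and>
        (\<forall>x v. (x \<in> U \<and> \<Phi> x < \<Phi> xb + ereal \<epsilon> \<and> v \<in> V \<and> v \<in> limiting_subdiff \<Phi> x) \<longleftrightarrow>
               (x \<in> U \<and> v \<in> V \<and> v \<in> limiting_subdiff \<psi> x)) \<and>
        (\<forall>x v. x \<in> U \<and> v \<in> V \<and> v \<in> limiting_subdiff \<psi> x \<longrightarrow> \<Phi> x = \<psi> x))"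

definition variationally_convex :: "('a::euclidean_space \<Rightarrow> ereal) \<Rightarrow> 'a \<Rightarrow> 'a \<Rightarrow> bool" where
  "variationally_convex \<Phi> xb vb \<longleftrightarrow> var_convex_gen ereal_convex_on \<Phi> xb vb"

definition strongly_variationally_convex :: "('a::euclidean_space \<Rightarrow> ereal) \<Rightarrow> 'a \<Rightarrow> 'a \<Rightarrow> real \<Rightarrow> bool" where
  "strongly_variationally_convex \<Phi> xb vb \<sigma> \<longleftrightarrow>
     \<sigma> > 0 \<and> var_convex_gen (\<lambda>U \<psi>. ereal_strongly_convex_on U \<sigma> \<psi>) \<Phi> xb vb"

definition local_minimizer :: "('a::metric_space \<Rightarrow> ereal) \<Rightarrow> 'a \<Rightarrow> bool" where
  "local_minimizer \<Phi> xb \<longleftrightarrow> (\<exists>\<delta>>0. \<forall>x\<in>ball xb \<delta>. \<Phi> xb \<le> \<Phi> x)"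

definition Mgamma :: "('a::euclidean_space \<Rightarrow> ereal) \<Rightarrow> 'a \<Rightarrow> real \<Rightarrow> 'a \<Rightarrow> 'a set" where
  "Mgamma \<Phi> xb \<gamma> v = {x. norm (x - xb) \<le> \<gamma> \<and>
     (\<forall>z. norm (z - xb) \<le> \<gamma> \<longrightarrow> \<Phi> x - ereal (v \<bullet> x) \<le> \<Phi> z - ereal (v \<bullet> z))}"

definition tilt_stable_min :: "('a::euclidean_space \<Rightarrow> ereal) \<Rightarrow> 'a \<Rightarrow> real \<Rightarrow> bool" where
  "tilt_stable_min \<Phi> xb \<kappa> \<longleftrightarrow> (\<exists>\<gamma>>0. Mgamma \<Phi> xb \<gamma> 0 = {xb} \<and>
     (\<exists>\<delta>>0. \<exists>M. (\<forall>v\<in>ball 0 \<delta>. Mgamma \<Phi> xb \<gamma> v = {M v}) \<and>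
        (\<forall>v\<in>ball 0 \<delta>. \<forall>w\<in>ball 0 \<delta>. dist (M v) (M w) \<le> \<kappa> * dist v w)))"

definition strong_local_minimizer :: "('a::real_normed_vector \<Rightarrow> ereal) \<Rightarrow> 'a \<Rightarrow> bool" where
  "strong_local_minimizer \<Phi> xb \<longleftrightarrow> (\<exists>c>0. \<exists>\<delta>>0. \<forall>x\<in>ball xb \<delta>.
      \<Phi> xb + ereal (c * (norm (x - xb))\<^sup>2) \<le> \<Phi> x)"

end

theory Submission
  imports Defs
begin

text \<open>By MSCQ, \<open>f - \<langle>v, \<cdot>\<rangle>\<close> plus a multiple of the constraint violation is an exact penalty function at a
  regular subgradient \<open>v\<close>, so \<open>v\<close> has a multiplier of uniformly bounded size. Bounded multipliers make
  \<open>\<Phi> = f + \<delta>\<^sub>\<Gamma>\<close> prox-regular, and limits of them turn the second-order condition into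
  \<open>\<langle>q, w\<rangle> \<ge> \<sigma> \<parallel>w\<parallel>\<^sup>2\<close> for every limit \<open>(w, q)\<close> of difference quotients in the graph of the
  subdifferential. Along the Lipschitz proximal map this is a lower bound on the Dini derivatives of the
  gradient of the Moreau envelope, which is therefore locally convex. Convexity of the envelope yields
  \<open>\<Phi> u \<ge> \<Phi> x + \<langle>v, u - x\<rangle> + \<sigma>/2 \<parallel>u - x\<parallel>\<^sup>2\<close> uniformly over the subdifferential graph near
  \<open>(xb, 0)\<close>. The supremum of these minorants is the convex function required by variational convexity:
  resolvents exist locally, so its subdifferential cannot be larger than that of \<open>\<Phi>\<close>.\<close>

section \<open>Bounded multipliers as points of a zonotope\<close>

text \<open>A segment between two feasible points may leave the feasible set, so the second-order
  condition cannot be integrated along it. In the coordinate \<open>z = x + v / (2 r)\<close>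
  (Minty's parametrization of the subdifferential graph) this obstacle disappears: prox-regularity
  bounds the failure of monotonicity by \<open>r\<close>, the quadratic \<open>r |x - z|^2\<close>
  outweighs it, and every \<open>z\<close> near \<open>xb\<close> belongs to exactly one nearby
  graph point. Segments in \<open>z\<close> therefore carry curves in the graph. These curves are
  merely Lipschitz, so derivatives are replaced by limits along subsequences, and monotonicity has
  to be read off from a single small step at each point. The change of coordinate lowers the modulus
  from \<open>\<sigma>\<close> to \<open>\<sigma> / (1 + \<sigma> / (2 r))\<close>; as (ii) asserts
  the exact modulus, the loss has to be undone on the way back to \<open>f\<close>. Every estimate
  before tilt stability allows \<open>\<sigma> = 0\<close>, so (i) and (ii) share one
  argument.\<close>

lemma zonotope_convex_compact:
  fixes g :: "'i \<Rightarrow> 'a::euclidean_space"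
  assumes "finite I"
  shows "convex {(\<Sum>i\<in>I. y i *\<^sub>R g i) | y. \<forall>i\<in>I. l i \<le> y i \<and> y i \<le> u i}
    \<and> compact {(\<Sum>i\<in>I. y i *\<^sub>R g i) | y. \<forall>i\<in>I. l i \<le> y i \<and> y i \<le> (u i :: real)}"
  using assms
proof (induction I)
  case empty
  have "{(\<Sum>i\<in>{}. y i *\<^sub>R g i) | y. \<forall>i\<in>{}. l i \<le> y i \<and> y i \<le> u i} = {0}" by auto
  then show ?case by simp
next
  case (insert j I)
  let ?Z = "{(\<Sum>i\<in>I. y i *\<^sub>R g i) | y. \<forall>i\<in>I. l i \<le> y i \<and> y i \<le> u i}"
  let ?S = "(\<lambda>t. t *\<^sub>R g j) ` {l j..u j}"
  \<comment> \<open>Splitting off one generator shows the set as the Minkowski sum of a segment and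
    a smaller zonotope; compactness and convexity both pass to sums.\<close>
  have "{(\<Sum>i\<in>insert j I. y i *\<^sub>R g i) | y. \<forall>i\<in>insert j I. l i \<le> y i \<and> y i \<le> u i}
      = {a + b | a b. a \<in> ?S \<and> b \<in> ?Z}" (is "?L = ?R")
  proof
    show "?L \<subseteq> ?R" using insert.hyps by fastforce
    show "?R \<subseteq> ?L"
    proof
      fix a assume "a \<in> ?R"
      then obtain t y where a: "a = t *\<^sub>R g j + (\<Sum>i\<in>I. y i *\<^sub>R g i)" "l j \<le> t" "t \<le> u j"
        "\<forall>i\<in>I. l i \<le> y i \<and> y i \<le> u i" by auto
      have "(\<Sum>i\<in>I. y i *\<^sub>R g i) = (\<Sum>i\<in>I. (y(j := t)) i *\<^sub>R g i)"
        using insert.hyps by (intro sum.cong) auto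
      with a insert.hyps show "a \<in> ?L" by (auto intro!: exI[of _ "y(j := t)"])
    qed
  qed
  moreover have "convex ?S"
    by (intro convex_linear_image) (auto intro!: linearI simp: algebra_simps)
  moreover have "compact ?S"
    by (intro compact_continuous_image continuous_intros) auto
  moreover have "{a + b | a b. a \<in> ?S \<and> b \<in> ?Z} = (\<Union>x\<in>?S. \<Union>y\<in>?Z. {x + y})" by blast
  ultimately show ?case
    using insert.IH compact_sums[of ?S ?Z] convex_sums[of ?S ?Z] by simp
qed

text \<open>The right-hand side of \<open>supp\<close> is the support function of the zonotope, so a
  point outside it would violate \<open>supp\<close> in a separating direction. This is a Farkas
  lemma with prescribed bounds on the coefficients, which is what later bounds the
  multipliers.\<close>

lemma zonotope_membership:
  fixes g :: "'i \<Rightarrow> 'a::euclidean_space"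
  assumes I: "finite I" and lu: "\<And>i. i \<in> I \<Longrightarrow> l i \<le> u i"
    and supp: "\<And>w. a \<bullet> w \<le> (\<Sum>i\<in>I. max (l i * (g i \<bullet> w)) (u i * (g i \<bullet> w)))"
  shows "\<exists>y. (\<forall>i\<in>I. l i \<le> y i \<and> y i \<le> u i) \<and> a = (\<Sum>i\<in>I. y i *\<^sub>R g i)"
proof (rule ccontr)
  assume no: "\<not> ?thesis"
  define Z where "Z = {(\<Sum>i\<in>I. y i *\<^sub>R g i) | y. \<forall>i\<in>I. l i \<le> y i \<and> y i \<le> u i}"
  have "convex Z" "closed Z"
    using zonotope_convex_compact[OF I, of g l u] compact_imp_closed by (auto simp: Z_def)
  moreover have "a \<notin> Z" using no by (auto simp: Z_def)
  ultimately obtain w b where w: "w \<bullet> a < b" "\<And>x. x \<in> Z \<Longrightarrow> b < w \<bullet> x"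
    using separating_hyperplane_closed_point[of Z a] by metis
  \<comment> \<open>A vertex that attains the support function in direction \<open>- w\<close>: each
    coefficient takes the endpoint with the larger contribution.\<close>
  define y where "y i = (if l i * (g i \<bullet> (-w)) \<le> u i * (g i \<bullet> (-w)) then u i else l i)" for i
  have "(\<Sum>i\<in>I. y i *\<^sub>R g i) \<in> Z" using lu by (auto simp: y_def Z_def)
  then have "b < w \<bullet> (\<Sum>i\<in>I. y i *\<^sub>R g i)" by (rule w)
  moreover have "(\<Sum>i\<in>I. y i *\<^sub>R g i) \<bullet> (-w) = (\<Sum>i\<in>I. max (l i * (g i \<bullet> (-w))) (u i * (g i \<bullet> (-w))))"
    unfolding inner_sum_left by (intro sum.cong) (auto simp: y_def max_def)
  ultimately show False using supp[of "-w"] w(1) by (simp add: inner_commute)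
qed

section \<open>Prox-regularity and convexity of the Moreau envelope\<close>

text \<open>For each slope \<open>- e\<close> the points that satisfy the lower bound form a compact
  set, and its largest element can only be \<open>b\<close>. One suitable \<open>t'\<close> per
  \<open>t\<close> and \<open>e\<close> suffices; limits along subsequences deliver no more than
  that.\<close>

lemma dini_monotone:
  fixes h :: "real \<Rightarrow> real"
  assumes ab: "a \<le> b" and cont: "continuous_on {a..b} h"
    and dini: "\<And>t e. a \<le> t \<Longrightarrow> t < b \<Longrightarrow> 0 < e \<Longrightarrow> \<exists>t'. t < t' \<and> t' \<le> b \<and> h t' - h t \<ge> - e * (t' - t)"
  shows "h a \<le> h b"
proof -
  have main: "h b \<ge> h a - e * (b - a)" if e: "e > 0" for e
  proof -
    define S where "S = {t \<in> {a..b}. h a - e * (t - a) \<le> h t}"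
    have "continuous_on {a..b} (\<lambda>t. h a - e * (t - a))"
      by (intro continuous_intros)
    then have "closed S"
      unfolding S_def using cont closed_atLeastAtMost by (rule continuous_on_closed_Collect_le)
    moreover have "bounded S"
      by (rule bounded_subset[OF bounded_closed_interval[of a b]]) (auto simp: S_def)
    ultimately have "compact S" by (simp add: compact_eq_bounded_closed)
    moreover have "a \<in> S" using ab by (simp add: S_def)
    ultimately obtain T where T: "T \<in> S" "\<And>t. t \<in> S \<Longrightarrow> t \<le> T"
      using compact_attains_sup[of S] by blast
    have "T = b"
    proof (rule ccontr)
      assume "T \<noteq> b"
      with T have "T < b" "a \<le> T" by (auto simp: S_def)
      then obtain t' where t': "T < t'" "t' \<le> b" "h t' - h T \<ge> - e * (t' - T)"
        using dini[of T e] e by blast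
      have "t' \<in> S" using t' T(1) by (auto simp: S_def algebra_simps)
      with T(2) t'(1) show False by force
    qed
    with T(1) show ?thesis by (simp add: S_def)
  qed
  show ?thesis
  proof (rule field_le_epsilon)
    fix e :: real assume "0 < e"
    then have "0 < e / (b - a + 1)" using ab by simp
    from main[OF this] have "h a \<le> h b + e * ((b - a) / (b - a + 1))" by simp
    also have "e * ((b - a) / (b - a + 1)) \<le> e * 1"
      using \<open>0 < e\<close> ab by (intro mult_left_mono) auto
    finally show "h a \<le> h b + e" by simp
  qed
qed

text \<open>The Frechet subgradients of \<open>f\<close> plus the indicator of
  \<open>\<Gamma>\<close>, in a real-valued form that keeps extended reals out of the
  estimates.\<close>

definition regular_subgradient :: "'a::euclidean_space set \<Rightarrow> ('a \<Rightarrow> real) \<Rightarrow> 'a \<Rightarrow> 'a \<Rightarrow> bool" where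
  "regular_subgradient \<Gamma> f x v \<longleftrightarrow> x \<in> \<Gamma> \<and>
     (\<forall>e>0. \<exists>d>0. \<forall>u\<in>\<Gamma> \<inter> ball x d. f x + v \<bullet> (u - x) - e * norm (u - x) \<le> f u)"

lemma regular_subgradient_of_quadratic_minorant:
  assumes "x \<in> \<Gamma>" "d > 0"
    and min: "\<And>u. u \<in> \<Gamma> \<Longrightarrow> u \<in> ball x d \<Longrightarrow> f x + v \<bullet> (u - x) - c * (norm (u - x))\<^sup>2 \<le> f u"
  shows "regular_subgradient \<Gamma> f x v"
  unfolding regular_subgradient_def
proof (intro conjI allI impI)
  fix e :: real assume e: "e > 0"
  define d' where "d' = min d (e / (\<bar>c\<bar> + 1))"
  show "\<exists>d>0. \<forall>u\<in>\<Gamma> \<inter> ball x d. f x + v \<bullet> (u - x) - e * norm (u - x) \<le> f u"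
  proof (intro exI[of _ d'] conjI ballI)
    show "d' > 0" using e assms(2) by (simp add: d'_def)
    fix u assume u: "u \<in> \<Gamma> \<inter> ball x d'"
    then have n: "norm (u - x) \<le> e / (\<bar>c\<bar> + 1)" "u \<in> ball x d"
      by (auto simp: d'_def dist_norm norm_minus_commute)
    have "c * (norm (u - x))\<^sup>2 \<le> (\<bar>c\<bar> + 1) * (norm (u - x))\<^sup>2"
      by (intro mult_right_mono) auto
    also have "\<dots> = ((\<bar>c\<bar> + 1) * norm (u - x)) * norm (u - x)" by (simp add: power2_eq_square)
    also have "\<dots> \<le> e * norm (u - x)"
      using n(1) by (intro mult_right_mono) (auto simp: field_simps)
    finally show "f x + v \<bullet> (u - x) - e * norm (u - x) \<le> f u"
      using min[of u] u n by auto
  qed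
qed (fact assms)

text \<open>\<open>prox\<close> is prox-regularity at \<open>xb\<close> for \<open>0\<close>: one
  constant \<open>r\<close> serves every regular subgradient near \<open>(xb, 0)\<close>.
  Compactness and continuity provide minimizers for the proximal subproblems.\<close>

locale prox_regular =
  fixes \<Gamma> :: "'a::euclidean_space set" and f :: "'a \<Rightarrow> real" and xb :: 'a and \<rho> r :: real
  assumes xb: "xb \<in> \<Gamma>" and \<rho>: "0 < \<rho>" and r: "0 < r"
    and comp: "compact (\<Gamma> \<inter> cball xb \<rho>)"
    and cont: "continuous_on (\<Gamma> \<inter> cball xb \<rho>) f"
    and crit: "regular_subgradient \<Gamma> f xb 0"
    and prox: "\<And>x v u. regular_subgradient \<Gamma> f x v \<Longrightarrow> norm (x - xb) < \<rho> \<Longrightarrow> norm v < \<rho> \<Longrightarrow>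
       u \<in> \<Gamma> \<Longrightarrow> norm (u - xb) \<le> \<rho> \<Longrightarrow> f x + v \<bullet> (u - x) - r / 2 * (norm (u - x))\<^sup>2 \<le> f u"
begin

text \<open>Adding the two quadratic minorants gives
  \<open>(v - v') . (x - x') \<ge> - r |x - x'|^2\<close>. Shifting by \<open>2 * r\<close>, twice
  this defect, makes the graph strongly monotone, so \<open>x\<close> depends on
  \<open>x + v / (2 r)\<close> with Lipschitz constant 2.\<close>

lemma hypomonotone:
  assumes "regular_subgradient \<Gamma> f x v" "norm (x - xb) < \<rho>" "norm v < \<rho>"
    and "regular_subgradient \<Gamma> f x' v'" "norm (x' - xb) < \<rho>" "norm v' < \<rho>"
  shows "norm (x - x') \<le> 2 * norm ((x + v /\<^sub>R (2 * r)) - (x' + v' /\<^sub>R (2 * r)))"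
proof -
  define D Z where "D = x - x'" and "Z = (x + v /\<^sub>R (2 * r)) - (x' + v' /\<^sub>R (2 * r))"
  have \<Gamma>: "x \<in> \<Gamma>" "x' \<in> \<Gamma>" using assms by (auto simp: regular_subgradient_def)
  have 1: "f x + v \<bullet> (x' - x) - r / 2 * (norm (x' - x))\<^sup>2 \<le> f x'"
    using prox[OF assms(1-3) \<Gamma>(2)] assms by simp
  have 2: "f x' + v' \<bullet> (x - x') - r / 2 * (norm (x - x'))\<^sup>2 \<le> f x"
    using prox[OF assms(4-6) \<Gamma>(1)] assms by simp
  have vZ: "v - v' = (2 * r) *\<^sub>R (Z - D)" using r by (simp add: Z_def D_def algebra_simps)
  have "(v - v') \<bullet> D \<ge> - r * (norm D)\<^sup>2"
    using 1 2 by (simp add: D_def algebra_simps norm_minus_commute inner_diff)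
  then have "2 * r * (Z \<bullet> D) \<ge> r * (norm D)\<^sup>2"
    unfolding vZ by (simp add: inner_diff_left algebra_simps power2_norm_eq_inner)
  then have "(norm D)\<^sup>2 \<le> 2 * (Z \<bullet> D)" using r by (simp add: algebra_simps)
  also have "\<dots> \<le> 2 * norm Z * norm D" using Cauchy_Schwarz_ineq2[of Z D] by simp
  finally have "norm D \<le> 2 * norm Z"
    by (cases "norm D = 0") (simp_all add: power2_eq_square)
  then show ?thesis by (simp add: D_def Z_def)
qed

text \<open>The minorant at the critical point \<open>xb\<close> loses only half of what the penalty
  \<open>r |x - z|^2\<close> gains, so comparing the minimizer with \<open>xb\<close> yields the
  factor 4. This keeps the minimizer inside the ball, where minimality turns into a subgradient. The
  factor \<open>10 * r\<close> is \<open>2 * r * (1 + 4)\<close>.\<close>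

lemma prox_exists:
  assumes z: "4 * norm (z - xb) < \<rho>" "10 * r * norm (z - xb) < \<rho>"
  shows "\<exists>x. regular_subgradient \<Gamma> f x ((2 * r) *\<^sub>R (z - x)) \<and> norm (x - xb) \<le> 4 * norm (z - xb) \<and>
     norm ((2 * r) *\<^sub>R (z - x)) \<le> 10 * r * norm (z - xb) \<and>
     (\<forall>u\<in>\<Gamma>. norm (u - xb) \<le> \<rho> \<longrightarrow> f x + r * (norm (x - z))\<^sup>2 \<le> f u + r * (norm (u - z))\<^sup>2)"
proof -
  have "xb \<in> \<Gamma> \<inter> cball xb \<rho>" using xb \<rho> by simp
  then obtain x where x: "x \<in> \<Gamma> \<inter> cball xb \<rho>"
    and xmin: "\<And>u. u \<in> \<Gamma> \<inter> cball xb \<rho> \<Longrightarrow> f x + r * (norm (x - z))\<^sup>2 \<le> f u + r * (norm (u - z))\<^sup>2"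
    using continuous_attains_inf[OF comp, of "\<lambda>u. f u + r * (norm (u - z))\<^sup>2"] cont
    by (force intro!: continuous_intros)
  have min: "f x + r * (norm (x - z))\<^sup>2 \<le> f u + r * (norm (u - z))\<^sup>2"
    if "u \<in> \<Gamma>" "norm (u - xb) \<le> \<rho>" for u
    using xmin[of u] that by (simp add: dist_norm norm_minus_commute)
  define D Z where "D = x - xb" and "Z = z - xb"
  have "f xb - r / 2 * (norm D)\<^sup>2 \<le> f x"
    using prox[OF crit, of x] x \<rho> by (simp add: D_def dist_norm norm_minus_commute)
  moreover have "f x + r * (norm (D - Z))\<^sup>2 \<le> f xb + r * (norm Z)\<^sup>2"
    using min[OF xb] \<rho> by (simp add: D_def Z_def norm_minus_commute)
  moreover have "(norm (D - Z))\<^sup>2 = (norm D)\<^sup>2 - 2 * (D \<bullet> Z) + (norm Z)\<^sup>2"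
    by (simp add: power2_norm_eq_inner inner_diff inner_commute algebra_simps)
  ultimately have "r * ((norm D)\<^sup>2) \<le> r * (4 * (D \<bullet> Z))" by (simp add: algebra_simps)
  then have "(norm D)\<^sup>2 \<le> 4 * (D \<bullet> Z)" using r by simp
  also have "\<dots> \<le> 4 * norm Z * norm D" using Cauchy_Schwarz_ineq2[of D Z] by (simp add: mult.commute)
  finally have D: "norm D \<le> 4 * norm Z"
    by (cases "norm D = 0") (simp_all add: power2_eq_square)
  have "norm (Z - D) \<le> 5 * norm Z" using D norm_triangle_ineq4[of Z D] by simp
  then have "2 * r * norm (Z - D) \<le> 10 * r * norm Z" using r by simp
  then have V: "norm ((2 * r) *\<^sub>R (z - x)) \<le> 10 * r * norm (z - xb)"
    using r by (simp add: Z_def D_def)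
  have "regular_subgradient \<Gamma> f x ((2 * r) *\<^sub>R (z - x))"
  proof (rule regular_subgradient_of_quadratic_minorant[where d="\<rho> - norm D" and c=r])
    show "x \<in> \<Gamma>" using x by simp
    show "0 < \<rho> - norm D" using D z by (simp add: Z_def)
    fix u assume u: "u \<in> \<Gamma>" "u \<in> ball x (\<rho> - norm D)"
    have "norm (u - xb) \<le> norm (u - x) + norm D"
      using norm_triangle_ineq[of "u - x" "x - xb"] by (simp add: D_def)
    then have "f x + r * (norm (x - z))\<^sup>2 \<le> f u + r * (norm (u - z))\<^sup>2"
      using u by (intro min) (auto simp: dist_norm norm_minus_commute)
    moreover have "(norm (u - z))\<^sup>2 = (norm (u - x))\<^sup>2 - 2 * ((z - x) \<bullet> (u - x)) + (norm (x - z))\<^sup>2"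
      by (simp add: power2_norm_eq_inner inner_diff inner_commute algebra_simps)
    ultimately show "f x + ((2 * r) *\<^sub>R (z - x)) \<bullet> (u - x) - r * (norm (u - x))\<^sup>2 \<le> f u"
      by (simp add: algebra_simps)
  qed
  with D V min show ?thesis unfolding D_def Z_def by blast
qed

end

text \<open>The pairs \<open>(w, q)\<close> are the tangent directions of the subdifferential graph
  at \<open>(x, v)\<close>, so \<open>inf_mono\<close> says that its graphical derivative has
  modulus \<open>\<sigma>\<close>.\<close>

locale prox_regular_infinitesimal = prox_regular +
  fixes \<sigma> :: real
  assumes \<sigma>: "0 \<le> \<sigma>"
    and inf_mono: "\<And>x v X V t w q.
      regular_subgradient \<Gamma> f x v \<Longrightarrow> norm (x - xb) < \<rho> \<Longrightarrow> norm v < \<rho> \<Longrightarrow>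
      (\<And>k. regular_subgradient \<Gamma> f (X k) (V k)) \<Longrightarrow>
      (\<And>k::nat. norm (X k - xb) < \<rho>) \<Longrightarrow> (\<And>k. norm (V k) < \<rho>) \<Longrightarrow>
      (\<And>k. 0 < t k) \<Longrightarrow> t \<longlonglongrightarrow> 0 \<Longrightarrow>
      (\<lambda>k. (X k - x) /\<^sub>R t k) \<longlonglongrightarrow> w \<Longrightarrow> (\<lambda>k. (V k - v) /\<^sub>R t k) \<longlonglongrightarrow> q \<Longrightarrow>
      \<sigma> * (norm w)\<^sup>2 \<le> q \<bullet> w"
begin

section \<open>The local Moreau envelope and its gradient\<close>

definition \<delta> where "\<delta> = min (\<rho> / 4) (\<rho> / (10 * r))"

text \<open>\<open>E\<close> is the local Moreau envelope with parameter \<open>1 / (2 * r)\<close>, \<open>P\<close> its proximal map, and \<open>V\<close> its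
  gradient. If \<open>\<sigma>\<close> is the modulus of \<open>f\<close>, the envelope only has the smaller modulus \<open>\<sigma>'\<close>.\<close>

definition P where "P z = (SOME x. regular_subgradient \<Gamma> f x ((2 * r) *\<^sub>R (z - x)) \<and>
     norm (x - xb) \<le> 4 * norm (z - xb) \<and> norm ((2 * r) *\<^sub>R (z - x)) \<le> 10 * r * norm (z - xb) \<and>
     (\<forall>u\<in>\<Gamma>. norm (u - xb) \<le> \<rho> \<longrightarrow> f x + r * (norm (x - z))\<^sup>2 \<le> f u + r * (norm (u - z))\<^sup>2))"

definition V where "V z = (2 * r) *\<^sub>R (z - P z)"

definition E where "E z = f (P z) + r * (norm (P z - z))\<^sup>2"

definition \<sigma>' where "\<sigma>' = 2 * r * \<sigma> / (2 * r + \<sigma>)"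

text \<open>For positive \<open>\<sigma>\<close> this is
  \<open>1 / \<sigma>' = 1 / \<sigma> + 1 / (2 * r)\<close>: inverse moduli add under infimal
  convolution, and the quadratic \<open>r |x|^2\<close> has modulus \<open>2 * r\<close>. The
  product form also covers \<open>\<sigma> = 0\<close>.\<close>

lemma \<sigma>'_eq: "(1 + \<sigma> / (2 * r)) * \<sigma>' = \<sigma>"
proof -
  have "1 + \<sigma> / (2 * r) = (2 * r + \<sigma>) / (2 * r)" using r by (simp add: add_divide_distrib)
  moreover have "2 * r + \<sigma> \<noteq> 0" using r \<sigma> by simp
  ultimately show ?thesis using r by (simp add: \<sigma>'_def)
qed

lemma \<delta>_pos: "\<delta> > 0" using \<rho> r by (simp add: \<delta>_def)

lemma small: assumes "z \<in> ball xb \<delta>" shows "4 * norm (z - xb) < \<rho>" "10 * r * norm (z - xb) < \<rho>"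
  using assms r by (auto simp: \<delta>_def dist_norm norm_minus_commute field_simps)

lemma P_props:
  assumes "z \<in> ball xb \<delta>"
  shows P_sub: "regular_subgradient \<Gamma> f (P z) (V z)"
    and P_near: "norm (P z - xb) < \<rho>"
    and V_near: "norm (V z) < \<rho>"
    and P_min: "\<And>u. u \<in> \<Gamma> \<Longrightarrow> norm (u - xb) \<le> \<rho> \<Longrightarrow> E z \<le> f u + r * (norm (u - z))\<^sup>2"
  using someI_ex[OF prox_exists[OF small[OF assms]]] small[OF assms]
  unfolding P_def[symmetric] V_def E_def by auto

lemma P_\<Gamma>: "z \<in> ball xb \<delta> \<Longrightarrow> P z \<in> \<Gamma>"
  using P_sub by (auto simp: regular_subgradient_def)

lemma P_V: "P z + V z /\<^sub>R (2 * r) = z"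
  using r by (simp add: V_def)

text \<open>Two graph points with the same value of \<open>x + v / (2 r)\<close> coincide by
  \<open>hypomonotone\<close>. Hence any graph point near \<open>(xb, 0)\<close> can be studied at
  its \<open>z\<close>.\<close>

lemma P_unique:
  assumes "regular_subgradient \<Gamma> f x v" "norm (x - xb) < \<rho>" "norm v < \<rho>"
    and z: "x + v /\<^sub>R (2 * r) \<in> ball xb \<delta>"
  shows "P (x + v /\<^sub>R (2 * r)) = x" "V (x + v /\<^sub>R (2 * r)) = v"
proof -
  show "P (x + v /\<^sub>R (2 * r)) = x"
    using hypomonotone[OF P_props(1-3)[OF z] assms(1-3)] unfolding P_V by simp
  then show "V (x + v /\<^sub>R (2 * r)) = v" using r by (simp add: V_def)
qed

lemma P_Lipschitz:
  assumes "z \<in> ball xb \<delta>" "z' \<in> ball xb \<delta>"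
  shows "norm (P z - P z') \<le> 2 * norm (z - z')"
  using hypomonotone[OF P_props(1-3)[OF assms(1)] P_props(1-3)[OF assms(2)]] unfolding P_V .

lemma continuous_on_P: "continuous_on (ball xb \<delta>) P"
proof (rule continuous_on_iff[THEN iffD2], intro ballI allI impI)
  fix x e assume "x \<in> ball xb \<delta>" "(0::real) < e"
  then show "\<exists>d>0. \<forall>x'\<in>ball xb \<delta>. dist x' x < d \<longrightarrow> dist (P x') (P x) < e"
    using P_Lipschitz[of _ x] by (intro exI[of _ "e/2"]) (force simp: dist_norm)
qed

lemma continuous_on_V: "continuous_on (ball xb \<delta>) V"
  unfolding V_def by (intro continuous_intros continuous_on_P)

text \<open>\<open>P z\<close> is an admissible competitor in the minimization at \<open>z'\<close>.
  Used from \<open>z\<close> to \<open>z'\<close> and back, this one-sided bound also yields the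
  derivative of \<open>E\<close>.\<close>

lemma E_descent:
  assumes "z \<in> ball xb \<delta>" "z' \<in> ball xb \<delta>"
  shows "E z' \<le> E z + V z \<bullet> (z' - z) + r * (norm (z' - z))\<^sup>2"
proof -
  have "E z' \<le> f (P z) + r * (norm (P z - z'))\<^sup>2"
    using P_min[OF assms(2) P_\<Gamma>[OF assms(1)]] P_near[OF assms(1)] by simp
  also have "(norm (P z - z'))\<^sup>2 = (norm (P z - z))\<^sup>2 + 2 * ((z - P z) \<bullet> (z' - z)) + (norm (z' - z))\<^sup>2"
    by (simp add: power2_norm_eq_inner inner_diff inner_commute algebra_simps)
  finally show ?thesis by (simp add: E_def V_def algebra_simps)
qed


text \<open>The quotients of \<open>P\<close> in direction \<open>d\<close> are bounded by
  \<open>2 * norm d\<close>, so a subsequence tends to some \<open>w\<close>. Since \<open>V\<close>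
  is \<open>2 r\<close> times identity minus \<open>P\<close>, those of \<open>V\<close> tend to
  \<open>q = 2 r (d - w)\<close> along it, and \<open>inf_mono\<close> applies to
  \<open>(w, q)\<close>. A limit along a subsequence controls only some arbitrarily small steps
  \<open>s\<close>, not all of them.\<close>

lemma V_dini:
  assumes z: "z \<in> ball xb \<delta>" and e: "e > 0" and b: "b > 0"
  shows "\<exists>s. 0 < s \<and> s < b \<and> (V (z + s *\<^sub>R d) - V z) \<bullet> d \<ge> s * (\<sigma>' * (norm d)\<^sup>2 - e)"
proof -
  obtain \<eta> where \<eta>: "\<eta> > 0" "ball z \<eta> \<subseteq> ball xb \<delta>"
    using z by (meson open_ball open_contains_ball)
  define b' where "b' = min b (\<eta> / (norm d + 1))"
  have b': "b' > 0" using b \<eta> by (auto simp: b'_def add_nonneg_pos)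
  \<comment> \<open>The \<open>+ 2\<close> makes \<open>t k\<close> positive and strictly smaller
    than \<open>b'\<close> already for \<open>k = 0\<close>.\<close>
  define t where "t k = b' / (real k + 2)" for k :: nat
  have t: "t k > 0" "t k < b'" for k
    using b' by (auto simp: t_def field_simps add_pos_nonneg)
  have tlim: "t \<longlonglongrightarrow> 0"
  proof -
    have "(\<lambda>k. b' * inverse (real (k + 2))) \<longlonglongrightarrow> b' * 0"
      by (intro tendsto_mult tendsto_const LIMSEQ_ignore_initial_segment lim_inverse_n)
    then show ?thesis by (simp add: t_def[abs_def] divide_inverse add.commute)
  qed
  have zt: "z + t k *\<^sub>R d \<in> ball xb \<delta>" for k
  proof -
    have "t k * norm d \<le> b' * norm d" using t(2)[of k] by (intro mult_right_mono) auto
    also have "\<dots> < b' * (norm d + 1)" using b' by simp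
    also have "\<dots> \<le> \<eta> / (norm d + 1) * (norm d + 1)" by (intro mult_right_mono) (auto simp: b'_def)
    also have "\<dots> = \<eta>" using norm_ge_zero[of d] by (simp add: add_nonneg_eq_0_iff)
    finally have "z + t k *\<^sub>R d \<in> ball z \<eta>" using t(1)[of k] by (simp add: dist_norm)
    then show ?thesis using \<eta>(2) by blast
  qed
  define W where "W k = (P (z + t k *\<^sub>R d) - P z) /\<^sub>R t k" for k
  have "norm (W k) \<le> 2 * norm d" for k
  proof -
    have "norm (W k) = norm (P (z + t k *\<^sub>R d) - P z) / t k"
      using t(1)[of k] by (simp add: W_def inverse_eq_divide)
    then show ?thesis
      using P_Lipschitz[OF zt[of k] z] t(1)[of k] by (simp add: pos_divide_le_eq mult_ac)
  qed
  then have "\<forall>k. W k \<in> cball 0 (2 * norm d)" by simp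
  then obtain w \<phi> where \<phi>: "strict_mono \<phi>" and w: "(W \<circ> \<phi>) \<longlonglongrightarrow> w"
    using compact_cball[of "0::'a" "2 * norm d"] unfolding compact_def by blast
  have VW: "(V (z + t k *\<^sub>R d) - V z) /\<^sub>R t k = (2 * r) *\<^sub>R (d - W k)" for k
    using t(1)[of k] by (simp add: V_def W_def scaleR_right_diff_distrib algebra_simps)
  define q where "q = (2 * r) *\<^sub>R (d - w)"
  have qlim: "(\<lambda>k. (V (z + t (\<phi> k) *\<^sub>R d) - V z) /\<^sub>R t (\<phi> k)) \<longlonglongrightarrow> q"
    unfolding VW q_def using w by (intro tendsto_intros) (simp add: o_def)
  have tl: "(t \<circ> \<phi>) \<longlonglongrightarrow> 0" using tlim \<phi> by (rule LIMSEQ_subseq_LIMSEQ)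
  have "\<sigma> * (norm w)\<^sup>2 \<le> q \<bullet> w"
  proof (rule inf_mono[OF P_sub[OF z] P_near[OF z] V_near[OF z] P_sub[OF zt[of "\<phi> _"]]
        P_near[OF zt[of "\<phi> _"]] V_near[OF zt[of "\<phi> _"]] t(1)[of "\<phi> _"]])
    show "(\<lambda>k. t (\<phi> k)) \<longlonglongrightarrow> 0" using tl by (simp add: o_def)
    show "(\<lambda>k. (P (z + t (\<phi> k) *\<^sub>R d) - P z) /\<^sub>R t (\<phi> k)) \<longlonglongrightarrow> w"
      using w by (simp add: o_def W_def)
  qed (fact qlim)
  define l where "l = 1 / (2 * r)"
  have l: "l > 0" using r by (simp add: l_def)
  have d: "d = w + l *\<^sub>R q" using r by (simp add: q_def l_def)
  \<comment> \<open>This square absorbs the cross term \<open>2 l \<sigma> (q . w)\<close> in the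
    expansion of \<open>\<sigma> |d|^2\<close> with \<open>d = w + l q\<close>. It is an equality
    for \<open>q = \<sigma> w\<close>, so no more modulus is lost than \<open>\<sigma>'\<close>
    records.\<close>
  have "0 \<le> (norm (\<sigma> *\<^sub>R w - q))\<^sup>2" by simp
  then have cs: "2 * \<sigma> * (q \<bullet> w) \<le> \<sigma>\<^sup>2 * (norm w)\<^sup>2 + (norm q)\<^sup>2"
    by (simp only: power2_norm_eq_inner) (simp add: inner_diff inner_commute algebra_simps power2_eq_square)
  have nd: "(norm d)\<^sup>2 = (norm w)\<^sup>2 + 2 * l * (q \<bullet> w) + l\<^sup>2 * (norm q)\<^sup>2"
    unfolding d power2_norm_eq_inner
    by (simp add: inner_add inner_commute algebra_simps power2_eq_square)
  have qd: "q \<bullet> d = q \<bullet> w + l * (norm q)\<^sup>2"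
    unfolding d power2_norm_eq_inner by (simp add: inner_add_right)
  have "\<sigma> * (norm d)\<^sup>2 \<le> (1 + l * \<sigma>) * (\<sigma> * (norm w)\<^sup>2 + l * (norm q)\<^sup>2)"
    unfolding nd using mult_left_mono[OF cs, of l] l
    by (simp add: algebra_simps power2_eq_square)
  also have "\<dots> \<le> (1 + l * \<sigma>) * (q \<bullet> d)"
    unfolding qd using \<open>\<sigma> * (norm w)\<^sup>2 \<le> q \<bullet> w\<close> l \<sigma> by (intro mult_left_mono) auto
  finally have "(1 + l * \<sigma>) * \<sigma>' * (norm d)\<^sup>2 \<le> (1 + l * \<sigma>) * (q \<bullet> d)"
    using \<sigma>'_eq by (simp add: l_def)
  then have "(1 + l * \<sigma>) * (\<sigma>' * (norm d)\<^sup>2) \<le> (1 + l * \<sigma>) * (q \<bullet> d)"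
    by (simp add: mult.assoc)
  then have "\<sigma>' * (norm d)\<^sup>2 \<le> q \<bullet> d"
    using l \<sigma> by (simp add: add_pos_nonneg)
  then have "\<sigma>' * (norm d)\<^sup>2 - e < q \<bullet> d" using e by simp
  moreover have "(\<lambda>k. ((V (z + t (\<phi> k) *\<^sub>R d) - V z) /\<^sub>R t (\<phi> k)) \<bullet> d) \<longlonglongrightarrow> q \<bullet> d"
    by (intro tendsto_intros qlim)
  ultimately have "eventually (\<lambda>k. \<sigma>' * (norm d)\<^sup>2 - e < ((V (z + t (\<phi> k) *\<^sub>R d) - V z) /\<^sub>R t (\<phi> k)) \<bullet> d) sequentially"
    by (simp add: order_tendsto_iff)
  then obtain k where k: "\<sigma>' * (norm d)\<^sup>2 - e < ((V (z + t (\<phi> k) *\<^sub>R d) - V z) /\<^sub>R t (\<phi> k)) \<bullet> d"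
    by (auto simp: eventually_sequentially)
  then have "(\<sigma>' * (norm d)\<^sup>2 - e) * t (\<phi> k) < (V (z + t (\<phi> k) *\<^sub>R d) - V z) \<bullet> d"
    using t(1)[of "\<phi> k"] by (simp only: inner_scaleR_left inverse_eq_divide) (simp add: field_simps)
  then show ?thesis
    using t[of "\<phi> k"] by (intro exI[of _ "t (\<phi> k)"]) (auto simp: b'_def mult.commute)
qed

lemma segment_in:
  assumes "z \<in> ball xb \<delta>" "z + d \<in> ball xb \<delta>" "0 \<le> t" "t \<le> 1"
  shows "z + t *\<^sub>R d \<in> ball xb \<delta>"
  using convexD_alt[OF convex_ball assms(1,2,3,4)] by (simp add: algebra_simps)

lemma V_strongly_monotone:
  assumes z: "z \<in> ball xb \<delta>" "z + d \<in> ball xb \<delta>"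
  shows "\<sigma>' * (norm d)\<^sup>2 \<le> (V (z + d) - V z) \<bullet> d"
proof -
  define h where "h t = V (z + t *\<^sub>R d) \<bullet> d - t * (\<sigma>' * (norm d)\<^sup>2)" for t
  have "h 0 \<le> h 1"
  proof (rule dini_monotone[where h=h and a=0 and b=1])
    show "continuous_on {0..1} h"
      unfolding h_def
      by (intro continuous_intros continuous_on_compose2[OF continuous_on_V])
        (use segment_in[OF z] in auto)
    fix t e :: real assume t: "0 \<le> t" "t < 1" "0 < e"
    then have zt: "z + t *\<^sub>R d \<in> ball xb \<delta>" using segment_in[OF z] by simp
    from V_dini[OF zt \<open>0 < e\<close>, of "1 - t" d] t obtain s where
      "0 < s" "s < 1 - t" "(V (z + t *\<^sub>R d + s *\<^sub>R d) - V (z + t *\<^sub>R d)) \<bullet> d \<ge> s * (\<sigma>' * (norm d)\<^sup>2 - e)"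
      by auto
    then show "\<exists>t'>t. t' \<le> 1 \<and> - e * (t' - t) \<le> h t' - h t"
      by (intro exI[of _ "t + s"]) (auto simp: h_def algebra_simps)
  qed simp
  then show ?thesis by (simp add: h_def inner_diff_left)
qed

text \<open>\<open>E_descent\<close> read from both ends of a subsegment squeezes the difference
  quotients of \<open>E\<close>, so continuity of \<open>V\<close> makes \<open>E\<close>
  differentiable along the segment with derivative \<open>V . d\<close>. Strong monotonicity of
  \<open>V\<close> is then integrated.\<close>

lemma E_strongly_convex:
  assumes z: "z \<in> ball xb \<delta>" "z + d \<in> ball xb \<delta>"
  shows "E z + V z \<bullet> d + \<sigma>' / 2 * (norm d)\<^sup>2 \<le> E (z + d)"
proof -
  define e where "e t = E (z + t *\<^sub>R d)" for t
  define h where "h t = V (z + t *\<^sub>R d) \<bullet> d" for t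
  note seg = segment_in[OF z]
  have hcont: "continuous_on {0..1} h"
    unfolding h_def
    by (intro continuous_intros continuous_on_compose2[OF continuous_on_V]) (use seg in auto)
  have up: "e t' - e t \<le> (t' - t) * h t + r * (norm d)\<^sup>2 * (t' - t)\<^sup>2" if "t \<in> {0..1}" "t' \<in> {0..1}" for t t'
  proof -
    have "z + t' *\<^sub>R d - (z + t *\<^sub>R d) = (t' - t) *\<^sub>R d" by (simp add: scaleR_diff_left)
    then show ?thesis
      using E_descent[OF seg[of t] seg[of t']] that by (simp add: e_def h_def power_mult_distrib mult_ac)
  qed
  have der: "(e has_real_derivative h t) (at t within {0..1})" if t: "t \<in> {0..1}" for t
    unfolding has_field_derivative_iff
  proof (rule tendsto_sandwich)
    \<comment> \<open>Which of \<open>h t\<close> and \<open>h u\<close> bounds the quotient from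
      above depends on the sign of \<open>u - t\<close>; \<open>min\<close> and \<open>max\<close>
      cover both cases.\<close>
    let ?l = "\<lambda>u. min (h t) (h u) - r * (norm d)\<^sup>2 * \<bar>u - t\<bar>"
    let ?u = "\<lambda>u. max (h t) (h u) + r * (norm d)\<^sup>2 * \<bar>u - t\<bar>"
    have hl: "(h \<longlongrightarrow> h t) (at t within {0..1})"
      using hcont t by (simp add: continuous_on_def)
    have "(?l \<longlongrightarrow> min (h t) (h t) - r * (norm d)\<^sup>2 * \<bar>t - t\<bar>) (at t within {0..1})"
      by (intro tendsto_intros hl)
    then show "(?l \<longlongrightarrow> h t) (at t within {0..1})" by simp
    have "(?u \<longlongrightarrow> max (h t) (h t) + r * (norm d)\<^sup>2 * \<bar>t - t\<bar>) (at t within {0..1})"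
      by (intro tendsto_intros hl)
    then show "(?u \<longlongrightarrow> h t) (at t within {0..1})" by simp
    have *: "?l u \<le> (e u - e t) / (u - t) \<and> (e u - e t) / (u - t) \<le> ?u u"
      if "u \<in> {0..1}" "u \<noteq> t" for u
    proof -
      note a = up[OF t that(1)] up[OF that(1) t]
      define D where "D = u - t"
      define c where "c = r * (norm d)\<^sup>2"
      have a': "e u - e t \<le> D * h t + c * D\<^sup>2" "e u - e t \<ge> D * h u - c * D\<^sup>2"
        using a by (auto simp: D_def c_def power2_commute[of t u] algebra_simps)
      show ?thesis
      proof (cases "D > 0")
        case True
        then have "(e u - e t) / D \<le> h t + c * D" "(e u - e t) / D \<ge> h u - c * D"
          using a' by (auto simp: field_simps power2_eq_square)
        then show ?thesis using True by (auto simp: D_def c_def)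
      next
        case False
        then have D: "D < 0" using that by (simp add: D_def)
        have "e u - e t \<le> (h t + c * D) * D" "(h u - c * D) * D \<le> e u - e t"
          using a' by (auto simp: algebra_simps power2_eq_square)
        then have "(e u - e t) / D \<ge> h t + c * D" "(e u - e t) / D \<le> h u - c * D"
          using D by (simp_all only: neg_le_divide_eq neg_divide_le_eq)
        moreover have "c * \<bar>u - t\<bar> = - (c * D)" using D by (simp add: D_def right_diff_distrib)
        ultimately show ?thesis unfolding c_def[symmetric] D_def[symmetric] by auto
      qed
    qed
    show "eventually (\<lambda>u. ?l u \<le> (e u - e t) / (u - t)) (at t within {0..1})"
      "eventually (\<lambda>u. (e u - e t) / (u - t) \<le> ?u u) (at t within {0..1})"
      unfolding eventually_at_filter using * by (auto intro!: always_eventually)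
  qed
  have mono: "t * (\<sigma>' * (norm d)\<^sup>2) \<le> h t - h 0" if "t \<in> {0..1}" for t
  proof (cases "t = 0")
    case False
    then have "t > 0" using that by simp
    have "\<sigma>' * (norm (t *\<^sub>R d))\<^sup>2 \<le> (V (z + t *\<^sub>R d) - V z) \<bullet> (t *\<^sub>R d)"
      by (rule V_strongly_monotone[OF z(1)]) (use seg[of t] that in simp)
    then have "t * (t * (\<sigma>' * (norm d)\<^sup>2)) \<le> t * (h t - h 0)"
      by (simp add: h_def power_mult_distrib power2_eq_square inner_diff_left algebra_simps)
    then show ?thesis using \<open>t > 0\<close> by simp
  qed simp
  define k where "k t = e t - t * h 0 - \<sigma>' / 2 * (norm d)\<^sup>2 * t\<^sup>2" for t
  have "k 0 \<le> k 1"
  proof (rule DERIV_nonneg_imp_increasing_open[where f=k])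
    fix t :: real assume t: "0 < t" "t < 1"
    then have "(e has_real_derivative h t) (at t)"
      using der[of t] at_within_Icc_at[of 0 t 1] by simp
    then have "(k has_real_derivative (h t - h 0 - \<sigma>' / 2 * (norm d)\<^sup>2 * (2 * t))) (at t)"
      unfolding k_def by (auto intro!: derivative_eq_intros)
    moreover have "0 \<le> h t - h 0 - \<sigma>' / 2 * (norm d)\<^sup>2 * (2 * t)"
      using mono[of t] t by (simp add: algebra_simps)
    ultimately show "\<exists>y. (k has_real_derivative y) (at t) \<and> 0 \<le> y" by blast
  next
    have "continuous_on {0..1} e" using der by (rule DERIV_continuous_on)
    then show "continuous_on {0..1} k" unfolding k_def by (intro continuous_intros)
  qed simp
  then show ?thesis by (simp add: k_def e_def h_def)
qed

text \<open>The envelope satisfies \<open>E z = f x + r |x - z|^2\<close> at the point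
  \<open>z\<close> that belongs to \<open>(x, v)\<close>, and
  \<open>E z' \<le> f u + r |u - z'|^2\<close> for every \<open>z'\<close> in the ball. Strong
  convexity of \<open>E\<close> between \<open>z\<close> and \<open>z'\<close> therefore bounds
  \<open>f u\<close> from below, and \<open>z'\<close> is free to be chosen.\<close>

theorem uniform_subgradient_inequality:
  "\<exists>\<rho>'>0. \<rho>' \<le> \<rho> \<and> (\<forall>x v u. regular_subgradient \<Gamma> f x v \<longrightarrow> norm (x - xb) < \<rho>' \<longrightarrow> norm v < \<rho>' \<longrightarrow>
     u \<in> \<Gamma> \<longrightarrow> norm (u - xb) < \<rho>' \<longrightarrow> f x + v \<bullet> (u - x) + \<sigma> / 2 * (norm (u - x))\<^sup>2 \<le> f u)"
proof -
  define l where "l = 1 / (2 * r)"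
  have l: "l > 0" using r by (simp add: l_def)
  \<comment> \<open>The points \<open>z\<close> and \<open>z'\<close> used below lie within
    \<open>(1 + l + 2 * l * \<sigma>) * \<rho>'\<close> of \<open>xb\<close>; the last summand comes
    from \<open>norm D < 2 * \<rho>'\<close>. The quotient puts both into the ball of radius
    \<open>\<delta>\<close>.\<close>
  define \<rho>' where "\<rho>' = min \<rho> (\<delta> / (1 + l + 2 * l * \<sigma>))"
  have pos: "0 < 1 + l + 2 * l * \<sigma>" using l \<sigma> by (simp add: add_pos_nonneg)
  have \<rho>': "\<rho>' > 0" "\<rho>' \<le> \<rho>" using \<rho> \<delta>_pos pos by (auto simp: \<rho>'_def)
  have \<rho>'\<delta>: "(1 + l + 2 * l * \<sigma>) * \<rho>' \<le> \<delta>"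
  proof -
    have "(1 + l + 2 * l * \<sigma>) * \<rho>' \<le> (1 + l + 2 * l * \<sigma>) * (\<delta> / (1 + l + 2 * l * \<sigma>))"
      using pos by (intro mult_left_mono) (auto simp: \<rho>'_def)
    also have "\<dots> = \<delta>" using pos by simp
    finally show ?thesis .
  qed
  show ?thesis
  proof (intro exI[of _ \<rho>'] conjI allI impI)
    fix x v u
    assume sub: "regular_subgradient \<Gamma> f x v" and x: "norm (x - xb) < \<rho>'" and v: "norm v < \<rho>'"
      and u\<Gamma>: "u \<in> \<Gamma>" and u: "norm (u - xb) < \<rho>'"
    define D where "D = u - x"
    define z where "z = x + v /\<^sub>R (2 * r)"
    \<comment> \<open>The shift by \<open>\<sigma> *\<^sub>R D\<close> is optimal: it recovers the full modulus \<open>\<sigma>\<close> from \<open>\<sigma>'\<close>.\<close>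
    define z' where "z' = u + l *\<^sub>R (v + \<sigma> *\<^sub>R D)"
    have ll: "v /\<^sub>R (2 * r) = l *\<^sub>R v" by (simp only: l_def inverse_eq_divide)
    have lv: "norm (l *\<^sub>R v) < l * \<rho>'" using v l by simp
    have "norm D < 2 * \<rho>'"
      using norm_triangle_ineq4[of "u - xb" "x - xb"] x u by (simp add: D_def)
    then have lD: "norm (l *\<^sub>R \<sigma> *\<^sub>R D) \<le> (2 * l * \<sigma>) * \<rho>'"
      using l \<sigma> mult_left_mono[of "norm D" "2 * \<rho>'" "l * \<sigma>"] by (simp add: algebra_simps)
    have nn: "0 \<le> 2 * l * \<sigma> * \<rho>'" using l \<sigma> \<rho>' by simp
    have "norm (z - xb) \<le> norm (x - xb) + norm (l *\<^sub>R v)"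
      unfolding z_def ll using norm_triangle_ineq[of "x - xb" "l *\<^sub>R v"] by (simp add: algebra_simps)
    also have "\<dots> < (1 + l + 2 * l * \<sigma>) * \<rho>'" using x lv nn by (simp add: algebra_simps)
    finally have z: "z \<in> ball xb \<delta>" using \<rho>'\<delta> by (simp add: dist_norm norm_minus_commute)
    have "z' - xb = (u - xb) + (l *\<^sub>R v + l *\<^sub>R \<sigma> *\<^sub>R D)" by (simp add: z'_def algebra_simps)
    then have "norm (z' - xb) \<le> norm (u - xb) + (norm (l *\<^sub>R v) + norm (l *\<^sub>R \<sigma> *\<^sub>R D))"
      by (metis norm_triangle_le norm_triangle_ineq add_left_mono)
    also have "\<dots> < (1 + l + 2 * l * \<sigma>) * \<rho>'" using u lv lD by (simp add: algebra_simps)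
    finally have z': "z' \<in> ball xb \<delta>" using \<rho>'\<delta> by (simp add: dist_norm norm_minus_commute)
    have PV: "P z = x" "V z = v"
      using P_unique[OF sub, folded z_def] x v \<rho>'(2) z by auto
    have "z = x + l *\<^sub>R v" by (simp only: z_def ll)
    then have zd: "z' = z + (1 + l * \<sigma>) *\<^sub>R D" by (simp add: z'_def D_def algebra_simps)
    have "E z + V z \<bullet> ((1 + l * \<sigma>) *\<^sub>R D) + \<sigma>' / 2 * (norm ((1 + l * \<sigma>) *\<^sub>R D))\<^sup>2 \<le> E z'"
      using E_strongly_convex[OF z, of "(1 + l * \<sigma>) *\<^sub>R D"] z' zd by simp
    also have "\<dots> \<le> f u + r * (norm (u - z'))\<^sup>2"
      using P_min[OF z' u\<Gamma>] u \<rho>' by simp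
    also have "(norm (u - z'))\<^sup>2 = l\<^sup>2 * ((norm v)\<^sup>2 + 2 * \<sigma> * (v \<bullet> D) + \<sigma>\<^sup>2 * (norm D)\<^sup>2)"
      by (simp add: z'_def power2_norm_eq_inner power_mult_distrib)
        (simp add: inner_add inner_commute power2_eq_square algebra_simps)
    also have "r * \<dots> = l / 2 * ((norm v)\<^sup>2 + 2 * \<sigma> * (v \<bullet> D) + \<sigma>\<^sup>2 * (norm D)\<^sup>2)"
      using r by (simp add: l_def power2_eq_square field_simps)
    also have "E z = f x + l / 2 * (norm v)\<^sup>2"
      unfolding E_def PV using r by (simp add: z_def ll power_mult_distrib) (simp add: l_def power2_eq_square field_simps)
    also have "\<sigma>' / 2 * (norm ((1 + l * \<sigma>) *\<^sub>R D))\<^sup>2 = \<sigma> / 2 * (1 + l * \<sigma>) * (norm D)\<^sup>2"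
    proof -
      have "\<sigma>' * (1 + l * \<sigma>) = \<sigma>" using \<sigma>'_eq by (simp add: l_def mult.commute)
      moreover have "\<sigma>' / 2 * (norm ((1 + l * \<sigma>) *\<^sub>R D))\<^sup>2
          = (\<sigma>' * (1 + l * \<sigma>)) / 2 * (1 + l * \<sigma>) * (norm D)\<^sup>2"
        by (simp add: power_mult_distrib power2_eq_square)
      ultimately show ?thesis by simp
    qed
    finally show "f x + v \<bullet> (u - x) + \<sigma> / 2 * (norm (u - x))\<^sup>2 \<le> f u"
      unfolding PV D_def[symmetric] by (simp add: algebra_simps add_divide_distrib power2_eq_square)
  qed (use \<rho>' in auto)
qed

end

section \<open>Second-order conditions for the nonlinear program\<close>

lemma grad_eqI:
  assumes "(f has_derivative (\<lambda>h. g \<bullet> h)) (at x)"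
  shows "grad f x = g"
  unfolding grad_def
proof (rule the_equality)
  fix g' assume "(f has_derivative (\<lambda>h. g' \<bullet> h)) (at x)"
  from has_derivative_unique[OF this assms] have "g' \<bullet> h = g \<bullet> h" for h by (rule fun_cong)
  then show "g' = g" using vector_eq_rdot by blast
qed (fact assms)

lemma has_derivative_grad:
  fixes f :: "'a::euclidean_space \<Rightarrow> real"
  assumes "f differentiable (at x)"
  shows "(f has_derivative (\<lambda>h. grad f x \<bullet> h)) (at x)"
proof -
  obtain D where D: "(f has_derivative D) (at x)" using assms by (auto simp: differentiable_def)
  define g where "g = (\<Sum>b\<in>Basis. D b *\<^sub>R b)"
  have "linear D" using D by (rule has_derivative_linear)
  then have "D h = g \<bullet> h" for h
    using linear_sum[of D "\<lambda>b. (h \<bullet> b) *\<^sub>R b" Basis]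
    by (simp add: euclidean_representation g_def inner_sum_left linear_cmul)
      (simp add: inner_commute mult.commute)
  then have "D = (\<lambda>h. g \<bullet> h)" by (rule ext)
  with D have "(f has_derivative (\<lambda>h. g \<bullet> h)) (at x)" by simp
  then show ?thesis by (simp add: grad_eqI)
qed

lemma has_derivative_hess:
  assumes "grad f differentiable (at x)"
  shows "(grad f has_derivative hess f x) (at x)"
proof -
  have "hess f x = frechet_derivative (grad f) (at x)" by (rule ext) (simp add: hess_def)
  then show ?thesis using assms by (simp add: frechet_derivative_works)
qed

text \<open>The quantitative content of \<open>C2_near\<close>, with a single radius and a single
  constant so that the objective and all constraints can share them.\<close>

definition C2_bound :: "('a::euclidean_space \<Rightarrow> real) \<Rightarrow> 'a \<Rightarrow> real \<Rightarrow> real \<Rightarrow> bool" where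
  "C2_bound f xb \<delta> c \<longleftrightarrow> (\<forall>x\<in>ball xb \<delta>. (f has_derivative (\<lambda>h. grad f x \<bullet> h)) (at x) \<and>
     (grad f has_derivative hess f x) (at x) \<and> norm (grad f x) \<le> c \<and>
     (\<forall>u\<in>ball xb \<delta>. \<bar>f u - f x - grad f x \<bullet> (u - x)\<bar> \<le> c * (norm (u - x))\<^sup>2))"

lemma C2_boundD:
  assumes "C2_bound f xb \<delta> c" "x \<in> ball xb \<delta>"
  shows "(f has_derivative (\<lambda>h. grad f x \<bullet> h)) (at x)"
    and "(grad f has_derivative hess f x) (at x)"
    and "norm (grad f x) \<le> c"
    and "u \<in> ball xb \<delta> \<Longrightarrow> \<bar>f u - f x - grad f x \<bullet> (u - x)\<bar> \<le> c * (norm (u - x))\<^sup>2"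
  using assms by (auto simp: C2_bound_def)

lemma C2_bound_mono:
  assumes "C2_bound f xb \<delta> c" "\<delta>' \<le> \<delta>" "c \<le> c'"
  shows "C2_bound f xb \<delta>' c'"
proof -
  have sub: "ball xb \<delta>' \<subseteq> ball xb \<delta>" using assms by auto
  have "\<bar>f u - f x - grad f x \<bullet> (u - x)\<bar> \<le> c' * (norm (u - x))\<^sup>2"
    if "u \<in> ball xb \<delta>'" "x \<in> ball xb \<delta>'" for u x
    using C2_boundD(4)[OF assms(1), of x u] sub that mult_right_mono[OF assms(3), of "(norm (u - x))\<^sup>2"]
    by (meson order_trans subsetD zero_le_power2)
  moreover have "norm (grad f x) \<le> c'" if "x \<in> ball xb \<delta>'" for x
    using C2_boundD(3)[OF assms(1), of x] sub that assms(3) by (meson order_trans subsetD)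
  ultimately show ?thesis
    using C2_boundD(1,2)[OF assms(1)] sub unfolding C2_bound_def by blast
qed

text \<open>Continuity of the Hessian is given only direction by direction, so it is bounded on each
  basis vector over a compact ball and the bounds are summed to an operator bound \<open>B\<close>.
  The mean value inequality then gives first a Lipschitz gradient and, applied once more, the Taylor
  remainder.\<close>

lemma C2_near_imp_C2_bound:
  fixes f :: "'a::euclidean_space \<Rightarrow> real"
  assumes "C2_near f xb"
  shows "\<exists>\<delta>>0. \<exists>c>0. C2_bound f xb \<delta> c"
proof -
  obtain N where N: "open N" "xb \<in> N" "\<And>x. x \<in> N \<Longrightarrow> f differentiable (at x)"
    "\<And>x. x \<in> N \<Longrightarrow> grad f differentiable (at x)" "\<And>h. continuous_on N (\<lambda>x. hess f x h)"
    using assms unfolding C2_near_def by blast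
  then obtain \<delta> where \<delta>: "\<delta> > 0" "cball xb \<delta> \<subseteq> N" by (meson open_contains_cball)
  have "\<exists>M. \<forall>x\<in>cball xb \<delta>. norm (hess f x b) \<le> M" for b
  proof -
    have "compact ((\<lambda>x. hess f x b) ` cball xb \<delta>)"
      by (intro compact_continuous_image continuous_on_subset[OF N(5) \<delta>(2)] compact_cball)
    then show ?thesis using compact_imp_bounded by (fastforce simp: bounded_iff)
  qed
  then obtain M where M: "\<And>b x. x \<in> cball xb \<delta> \<Longrightarrow> norm (hess f x b) \<le> M b" by metis
  define B where "B = (\<Sum>b\<in>Basis. M b)"
  have "M b \<ge> 0" for b using M[of xb b] \<delta> by (force intro: order_trans[OF norm_ge_zero])
  then have B0: "B \<ge> 0" by (simp add: B_def sum_nonneg)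
  have dg: "(grad f has_derivative hess f x) (at x)" if "x \<in> cball xb \<delta>" for x
    using has_derivative_hess N(4) \<delta>(2) that by blast
  have df: "(f has_derivative (\<lambda>h. grad f x \<bullet> h)) (at x)" if "x \<in> cball xb \<delta>" for x
    using has_derivative_grad N(3) \<delta>(2) that by blast
  have hB: "norm (hess f x h) \<le> B * norm h" if x: "x \<in> cball xb \<delta>" for x h
  proof -
    have "linear (hess f x)" using dg[OF x] by (rule has_derivative_linear)
    then have "hess f x h = (\<Sum>b\<in>Basis. (h \<bullet> b) *\<^sub>R hess f x b)"
      using linear_sum[of "hess f x" "\<lambda>b. (h \<bullet> b) *\<^sub>R b" Basis]
      by (simp add: euclidean_representation linear_cmul)
    also have "norm \<dots> \<le> (\<Sum>b\<in>Basis. M b * norm h)"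
    proof (rule sum_norm_le)
      fix b :: 'a assume "b \<in> Basis"
      then have "\<bar>h \<bullet> b\<bar> * norm (hess f x b) \<le> norm h * M b"
        using M[OF x] Basis_le_norm[of b h] by (intro mult_mono) auto
      then show "norm ((h \<bullet> b) *\<^sub>R hess f x b) \<le> M b * norm h" by (simp add: mult.commute)
    qed
    finally show ?thesis by (simp add: B_def sum_distrib_right)
  qed
  have lip: "norm (grad f u - grad f x) \<le> B * norm (u - x)"
    if "u \<in> cball xb \<delta>" "x \<in> cball xb \<delta>" for u x
  proof (rule differentiable_bound[OF convex_cball[of xb \<delta>] _ _ that])
    show "(grad f has_derivative hess f y) (at y within cball xb \<delta>)" if "y \<in> cball xb \<delta>" for y
      using dg[OF that] by (rule has_derivative_at_withinI)
    show "onorm (hess f y) \<le> B" if "y \<in> cball xb \<delta>" for y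
      using hB[OF that] by (rule onorm_le)
  qed
  have taylor: "\<bar>f u - f x - grad f x \<bullet> (u - x)\<bar> \<le> B * (norm (u - x))\<^sup>2"
    if "u \<in> cball xb \<delta>" "x \<in> cball xb \<delta>" for u x
  proof -
    have seg: "closed_segment x u \<subseteq> cball xb \<delta>"
      using that by (intro closed_segment_subset convex_cball)
    \<comment> \<open>Subtracting the linear part leaves a function whose derivative on the segment
      is at most \<open>B * norm (u - x)\<close>. The resulting constant \<open>B\<close>, instead
      of \<open>B / 2\<close>, is good enough.\<close>
    have "norm ((f u - grad f x \<bullet> u) - (f x - grad f x \<bullet> x)) \<le> (B * norm (u - x)) * norm (u - x)"
    proof (rule differentiable_bound[OF convex_closed_segment[of x u]])
      fix y assume y: "y \<in> closed_segment x u"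
      then have yc: "y \<in> cball xb \<delta>" using seg by blast
      show "((\<lambda>y. f y - grad f x \<bullet> y) has_derivative (\<lambda>h. grad f y \<bullet> h - grad f x \<bullet> h)) (at y within closed_segment x u)"
        by (intro derivative_intros has_derivative_at_withinI[OF df[OF yc]])
      show "onorm (\<lambda>h. grad f y \<bullet> h - grad f x \<bullet> h) \<le> B * norm (u - x)"
      proof (rule onorm_le)
        fix h
        have "\<bar>(grad f y - grad f x) \<bullet> h\<bar> \<le> norm (grad f y - grad f x) * norm h"
          by (rule Cauchy_Schwarz_ineq2)
        also have "\<dots> \<le> (B * norm (y - x)) * norm h"
          using lip[OF yc that(2)] by (intro mult_right_mono) auto
        also have "\<dots> \<le> (B * norm (u - x)) * norm h"
          using segment_bound(1)[OF y] B0 by (intro mult_right_mono mult_left_mono) (auto simp: norm_minus_commute)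
        finally show "norm (grad f y \<bullet> h - grad f x \<bullet> h) \<le> (B * norm (u - x)) * norm h"
          by (simp add: inner_diff_left)
      qed
    qed auto
    then show ?thesis by (simp add: inner_diff_right power2_eq_square algebra_simps)
  qed
  define c where "c = B + B * \<delta> + norm (grad f xb) + 1"
  have c: "B \<le> c" "c > 0" "B * \<delta> + norm (grad f xb) \<le> c"
    using B0 \<delta> by (auto simp: c_def intro!: add_nonneg_pos)
  have "norm (grad f x) \<le> c" if x: "x \<in> cball xb \<delta>" for x
  proof -
    have "norm (grad f x) \<le> norm (grad f x - grad f xb) + norm (grad f xb)"
      using norm_triangle_ineq[of "grad f x - grad f xb" "grad f xb"] by simp
    also have "norm (grad f x - grad f xb) \<le> B * norm (x - xb)" using lip[OF x, of xb] \<delta> by simp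
    also have "\<dots> \<le> B * \<delta>" using x B0 by (intro mult_left_mono) (auto simp: dist_norm norm_minus_commute)
    finally show ?thesis using c by simp
  qed
  moreover have "\<bar>f u - f x - grad f x \<bullet> (u - x)\<bar> \<le> c * (norm (u - x))\<^sup>2"
    if "u \<in> cball xb \<delta>" "x \<in> cball xb \<delta>" for u x
    using taylor[OF that] mult_right_mono[OF c(1), of "(norm (u - x))\<^sup>2"] by simp
  ultimately have "C2_bound f xb \<delta> c" using dg df unfolding C2_bound_def by auto
  then show ?thesis using \<delta>(1) c(2) by blast
qed

lemma C2_near_uniform_bound:
  assumes "finite I" "\<And>i. i \<in> I \<Longrightarrow> C2_near (F i) xb"
  shows "\<exists>\<delta>>0. \<exists>c>0. \<forall>i\<in>I. C2_bound (F i) xb \<delta> c"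
  using assms
proof (induction I)
  case empty
  show ?case by (auto intro!: exI[of _ 1])
next
  case (insert j I)
  have "\<exists>\<delta>>0. \<exists>c>0. \<forall>i\<in>I. C2_bound (F i) xb \<delta> c"
    by (rule insert.IH) (rule insert.prems, simp)
  then obtain \<delta> c where 1: "\<delta> > 0" "c > 0" "\<And>i. i \<in> I \<Longrightarrow> C2_bound (F i) xb \<delta> c" by blast
  obtain \<delta>' c' where 2: "\<delta>' > 0" "c' > 0" "C2_bound (F j) xb \<delta>' c'"
    using C2_near_imp_C2_bound[OF insert.prems[of j]] by blast
  have "min \<delta> \<delta>' > 0" "max c c' > 0" using 1(1,2) 2(1,2) by auto
  moreover have "C2_bound (F i) xb (min \<delta> \<delta>') (max c c')" if "i \<in> insert j I" for i
  proof (cases "i = j")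
    case True
    show ?thesis unfolding True by (rule C2_bound_mono[OF 2(3)]) auto
  next
    case False
    with that have "i \<in> I" by simp
    show ?thesis by (rule C2_bound_mono[OF 1(3)[OF \<open>i \<in> I\<close>]]) auto
  qed
  ultimately show ?case by (intro exI[of _ "min \<delta> \<delta>'"] exI[of _ "max c c'"] conjI ballI)
qed

section \<open>One-sided difference quotients\<close>

lemma max_quotient_tendsto:
  fixes h :: "real \<Rightarrow> real"
  assumes "((\<lambda>t. h t / t) \<longlongrightarrow> g) (at_right 0)"
  shows "((\<lambda>t. max (h t) 0 / t) \<longlongrightarrow> max g 0) (at_right 0)"
proof -
  have "((\<lambda>t. max (h t / t) 0) \<longlongrightarrow> max g 0) (at_right 0)" by (rule tendsto_max[OF assms tendsto_const])
  moreover have "eventually (\<lambda>t. max (h t / t) 0 = max (h t) 0 / t) (at_right 0)"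
    using eventually_at_right_less[of 0] by eventually_elim (auto simp: max_def divide_simps)
  ultimately show ?thesis by (rule Lim_transform_eventually)
qed

lemma abs_quotient_tendsto:
  fixes h :: "real \<Rightarrow> real"
  assumes "((\<lambda>t. h t / t) \<longlongrightarrow> g) (at_right 0)"
  shows "((\<lambda>t. \<bar>h t\<bar> / t) \<longlongrightarrow> \<bar>g\<bar>) (at_right 0)"
proof -
  have "((\<lambda>t. \<bar>h t / t\<bar>) \<longlongrightarrow> \<bar>g\<bar>) (at_right 0)" by (rule tendsto_rabs[OF assms])
  moreover have "eventually (\<lambda>t. \<bar>h t / t\<bar> = \<bar>h t\<bar> / t) (at_right 0)"
    using eventually_at_right_less[of 0] by eventually_elim simp
  ultimately show ?thesis by (rule Lim_transform_eventually)
qed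

lemma directional_quotient_tendsto:
  fixes h :: "'a::euclidean_space \<Rightarrow> real"
  assumes "(h has_derivative (\<lambda>w. g \<bullet> w)) (at x)"
  shows "((\<lambda>t. (h (x + t *\<^sub>R w) - h x) / t) \<longlongrightarrow> g \<bullet> w) (at_right 0)"
proof -
  have "((\<lambda>t. x + t *\<^sub>R w) has_derivative (\<lambda>t. t *\<^sub>R w)) (at 0)"
    by (auto intro!: derivative_eq_intros)
  moreover have "(h has_derivative (\<lambda>w. g \<bullet> w)) (at (x + 0 *\<^sub>R w))" using assms by simp
  ultimately have "((\<lambda>t. h (x + t *\<^sub>R w)) has_derivative (\<lambda>t. g \<bullet> (t *\<^sub>R w))) (at 0)"
    by (rule has_derivative_compose)
  then have "((\<lambda>t. h (x + t *\<^sub>R w)) has_real_derivative (g \<bullet> w)) (at 0)"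
    by (simp add: has_field_derivative_def mult_commute_abs)
  then have "((\<lambda>t. (h (x + t *\<^sub>R w) - h x) / t) \<longlongrightarrow> g \<bullet> w) (at 0)"
    by (simp add: has_field_derivative_iff)
  then show ?thesis by (rule tendsto_mono[OF at_le, rotated]) simp
qed

section \<open>Exact penalization and bounded multipliers\<close>

locale nlp =
  fixes f :: "'a::euclidean_space \<Rightarrow> real" and \<phi> :: "nat \<Rightarrow> 'a \<Rightarrow> real"
    and s m :: nat and xb :: 'a and \<delta> c \<kappa> :: real
  assumes sm: "s \<le> m" and \<delta>: "\<delta> > 0" and c: "c > 0" and \<kappa>: "\<kappa> > 0"
    and f_bound: "C2_bound f xb \<delta> c"
    and \<phi>_bound: "\<And>i. i \<in> {1..m} \<Longrightarrow> C2_bound (\<phi> i) xb \<delta> c"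
    and mscq: "\<And>x. x \<in> ball xb \<delta> \<Longrightarrow> infdist x (feas \<phi> s m) \<le>
        \<kappa> * ((\<Sum>i=1..s. max (\<phi> i x) 0) + (\<Sum>i=s+1..m. \<bar>\<phi> i x\<bar>))"
begin

abbreviation "\<Gamma> \<equiv> feas \<phi> s m"

text \<open>The penalty weight: \<open>v - grad f x\<close> has norm at most \<open>c + 1\<close>
  when \<open>norm v \<le> 1\<close>, and \<open>\<kappa>\<close> converts constraint violation into
  distance. The same number later bounds every multiplier.\<close>

definition K where "K = \<kappa> * (c + 1)"

lemma K: "K > 0" using \<kappa> c by (simp add: K_def)

lemma split_sum: "(\<Sum>i=1..s. a i) + (\<Sum>i=s+1..m. b i) = (\<Sum>i=1..m. if i \<le> s then a i else (b i :: real))"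
proof -
  have "{1..m} = {1..s} \<union> {s+1..m}" using sm by auto
  then show ?thesis by (simp add: sum.union_disjoint)
qed

text \<open>The Taylor bound removes \<open>f\<close> from the subgradient inequality, which leaves
  \<open>v - grad f x\<close> as a regular normal to \<open>\<Gamma>\<close> at \<open>x\<close>.
  Half of \<open>e\<close> pays for the Taylor remainder, the other half for the subgradient
  error.\<close>

lemma normal_direction:
  assumes x: "x \<in> ball xb \<delta>" and sub: "regular_subgradient \<Gamma> f x v" and e: "e > 0"
  shows "\<exists>d>0. \<forall>u\<in>\<Gamma> \<inter> ball x d. (v - grad f x) \<bullet> (u - x) \<le> e * norm (u - x)"
proof -
  obtain d1 where d1: "d1 > 0"
    "\<And>u. u \<in> \<Gamma> \<inter> ball x d1 \<Longrightarrow> f x + v \<bullet> (u - x) - e / 2 * norm (u - x) \<le> f u"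
    using sub e unfolding regular_subgradient_def by (metis half_gt_zero)
  obtain d2 where d2: "d2 > 0" "ball x d2 \<subseteq> ball xb \<delta>"
    using x by (meson open_ball open_contains_ball)
  define d where "d = min (min d1 d2) (e / (2 * c))"
  show ?thesis
  proof (intro exI[of _ d] conjI ballI)
    show "d > 0" using d1 d2 e c by (simp add: d_def)
    fix u assume u: "u \<in> \<Gamma> \<inter> ball x d"
    then have u2: "u \<in> ball xb \<delta>" using d2 by (auto simp: d_def)
    have "norm (u - x) \<le> e / (2 * c)" using u by (simp add: d_def dist_norm norm_minus_commute)
    then have "c * norm (u - x) \<le> e / 2" using c by (simp add: field_simps)
    from mult_right_mono[OF this, of "norm (u - x)"]
    have "c * (norm (u - x))\<^sup>2 \<le> e / 2 * norm (u - x)" by (simp add: power2_eq_square)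
    moreover have "f u \<le> f x + grad f x \<bullet> (u - x) + c * (norm (u - x))\<^sup>2"
      using C2_boundD(4)[OF f_bound x u2] by linarith
    moreover have "f x + v \<bullet> (u - x) - e / 2 * norm (u - x) \<le> f u"
      using u by (intro d1) (auto simp: d_def)
    ultimately show "(v - grad f x) \<bullet> (u - x) \<le> e * norm (u - x)"
      by (simp add: inner_diff_left)
  qed
qed

text \<open>The limit is the directional derivative of the constraint violation. An inactive
  inequality stays strictly satisfied for small \<open>t\<close> by continuity and contributes
  nothing.\<close>

lemma penalty_quotient_tendsto:
  assumes x: "x \<in> ball xb \<delta>" and x\<Gamma>: "x \<in> \<Gamma>"
  shows "((\<lambda>t. (\<Sum>i=1..m. if i \<le> s then max (\<phi> i (x + t *\<^sub>R w)) 0 else \<bar>\<phi> i (x + t *\<^sub>R w)\<bar>) / t)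
    \<longlongrightarrow> (\<Sum>i=1..m. if i \<le> s then (if \<phi> i x = 0 then max (grad (\<phi> i) x \<bullet> w) 0 else 0)
           else \<bar>grad (\<phi> i) x \<bullet> w\<bar>)) (at_right 0)"
  unfolding sum_divide_distrib
proof (rule tendsto_sum)
  fix i assume i: "i \<in> {1..m}"
  note D = C2_boundD(1)[OF \<phi>_bound[OF i] x]
  note Q = directional_quotient_tendsto[OF D, of w]
  show "((\<lambda>t. (if i \<le> s then max (\<phi> i (x + t *\<^sub>R w)) 0 else \<bar>\<phi> i (x + t *\<^sub>R w)\<bar>) / t) \<longlongrightarrow>
     (if i \<le> s then (if \<phi> i x = 0 then max (grad (\<phi> i) x \<bullet> w) 0 else 0)
           else \<bar>grad (\<phi> i) x \<bullet> w\<bar>)) (at_right 0)"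
  proof (cases "i \<le> s")
    case False
    then have "\<phi> i x = 0" using x\<Gamma> i by (auto simp: feas_def)
    then show ?thesis using abs_quotient_tendsto[of "\<lambda>t. \<phi> i (x + t *\<^sub>R w)"] Q False by simp
  next
    case True
    show ?thesis
    proof (cases "\<phi> i x = 0")
      case 0: True
      then show ?thesis using max_quotient_tendsto[of "\<lambda>t. \<phi> i (x + t *\<^sub>R w)"] Q True by simp
    next
      case neg: False
      then have "\<phi> i x < 0" using x\<Gamma> i True by (force simp: feas_def)
      have "isCont (\<phi> i) x" using D by (rule has_derivative_continuous)
      then have "(\<phi> i \<longlongrightarrow> \<phi> i x) (nhds x)" by (simp add: tendsto_nhds_iff isCont_def)
      moreover have "((\<lambda>t. x + t *\<^sub>R w) \<longlongrightarrow> x + 0 *\<^sub>R w) (at_right 0)" by (intro tendsto_intros)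
      ultimately have "((\<lambda>t. \<phi> i (x + t *\<^sub>R w)) \<longlongrightarrow> \<phi> i x) (at_right 0)"
        by (auto intro: filterlim_compose)
      then have "eventually (\<lambda>t. \<phi> i (x + t *\<^sub>R w) < 0) (at_right 0)"
        using \<open>\<phi> i x < 0\<close> by (rule order_tendstoD)
      then have "eventually (\<lambda>t. 0 = max (\<phi> i (x + t *\<^sub>R w)) 0 / t) (at_right 0)"
        by eventually_elim simp
      then have "((\<lambda>t. max (\<phi> i (x + t *\<^sub>R w)) 0 / t) \<longlongrightarrow> 0) (at_right 0)"
        by (rule Lim_transform_eventually[OF tendsto_const])
      then show ?thesis using True neg by simp
    qed
  qed
qed

text \<open>The direction \<open>w\<close> need not be tangent to \<open>\<Gamma>\<close>. The point
  \<open>x + t w\<close> is therefore moved back into \<open>\<Gamma>\<close>, at a cost that MSCQ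
  bounds by the violation; normality is applied at the corrected point, and division by
  \<open>t\<close> leaves the directional derivative of the violation.\<close>

lemma exact_penalty:
  assumes x: "x \<in> ball xb \<delta>" and sub: "regular_subgradient \<Gamma> f x v" and v: "norm v \<le> 1"
  shows "(v - grad f x) \<bullet> w \<le> K * (\<Sum>i=1..m. if i \<le> s then (if \<phi> i x = 0 then max (grad (\<phi> i) x \<bullet> w) 0 else 0)
           else \<bar>grad (\<phi> i) x \<bullet> w\<bar>)" (is "?a \<bullet> w \<le> K * ?q")
proof -
  define p where "p u = (\<Sum>i=1..m. if i \<le> s then max (\<phi> i u) 0 else \<bar>\<phi> i u\<bar>)" for u
  have x\<Gamma>: "x \<in> \<Gamma>" using sub by (simp add: regular_subgradient_def)
  then have ne: "\<Gamma> \<noteq> {}" by blast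
  have a: "norm ?a \<le> c + 1"
    using norm_triangle_ineq4[of v "grad f x"] v C2_boundD(3)[OF f_bound x] by simp
  have lim: "((\<lambda>t. p (x + t *\<^sub>R w) / t) \<longlongrightarrow> ?q) (at_right 0)"
    unfolding p_def by (rule penalty_quotient_tendsto[OF x x\<Gamma>])
  obtain d2 where d2: "d2 > 0" "ball x d2 \<subseteq> ball xb \<delta>"
    using x by (meson open_ball open_contains_ball)
  \<comment> \<open>Collects the two errors of order \<open>e * t\<close>: \<open>c + 1\<close>
    multiplies the slack in the choice of the feasible point \<open>z\<close>, and
    \<open>2 * norm w + 1\<close> bounds \<open>norm (z - x) / t\<close> in the normality
    estimate.\<close>
  define C where "C = c + 1 + 2 * norm w + 1"
  have C: "C > 0" using c by (simp add: C_def add_pos_nonneg)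
  have main: "?a \<bullet> w \<le> K * ?q + e * C" if e: "0 < e" "e \<le> 1" for e
  proof -
    obtain d where d: "d > 0" "\<And>u. u \<in> \<Gamma> \<inter> ball x d \<Longrightarrow> ?a \<bullet> (u - x) \<le> e * norm (u - x)"
      using normal_direction[OF x sub e(1)] by blast
    define b where "b = min d d2 / (2 * norm w + 1)"
    have nw: "0 < 2 * norm w + 1" by (simp add: add_nonneg_pos)
    then have b: "b > 0" using d d2 by (simp add: b_def)
    have ev: "?a \<bullet> w \<le> K * (p (x + t *\<^sub>R w) / t) + e * C" if t: "0 < t" "t < b" for t
    proof -
      define u where "u = x + t *\<^sub>R w"
      have tb: "t * (2 * norm w + 1) < min d d2" using t nw by (simp add: b_def pos_less_divide_eq)
      have tw: "norm (u - x) = t * norm w" using t by (simp add: u_def)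
      have "t * norm w \<le> t * (2 * norm w + 1)" using t by (intro mult_left_mono) auto
      then have "u \<in> ball x d2" using tb tw by (simp add: dist_norm norm_minus_commute)
      then have "u \<in> ball xb \<delta>" using d2 by blast
      then have ip: "infdist u \<Gamma> \<le> \<kappa> * p u" using mscq[of u] unfolding p_def split_sum by simp
      \<comment> \<open>\<open>\<Gamma>\<close> need not be closed away from \<open>xb\<close>, so a
        point that is nearest up to \<open>e * t\<close> replaces a projection.\<close>
      have "(INF z\<in>\<Gamma>. dist u z) < infdist u \<Gamma> + e * t"
        using ne e t by (simp add: infdist_notempty)
      then obtain z where z: "z \<in> \<Gamma>" "dist u z < infdist u \<Gamma> + e * t"
        using ne by (subst (asm) cINF_less_iff) (auto intro: bdd_belowI2[of _ 0])
      have "infdist u \<Gamma> \<le> t * norm w" using infdist_le[OF x\<Gamma>, of u] tw by (simp add: dist_norm)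
      moreover have "e * t \<le> t" using e t by simp
      ultimately have "norm (z - x) \<le> t * (2 * norm w + 1)"
        using z(2) tw norm_triangle_ineq[of "z - u" "u - x"]
        by (simp add: dist_norm norm_minus_commute algebra_simps)
      then have zx: "norm (z - x) \<le> t * (2 * norm w + 1)" "z \<in> ball x d"
        using tb by (auto simp: dist_norm norm_minus_commute)
      have "t * (?a \<bullet> w) = ?a \<bullet> (u - z) + ?a \<bullet> (z - x)" by (simp add: u_def inner_diff_right algebra_simps)
      also have "?a \<bullet> (z - x) \<le> e * (t * (2 * norm w + 1))"
        using d(2)[of z] z(1) zx(2) mult_left_mono[OF zx(1), of e] e(1)
        by (meson IntI less_imp_le order_trans)
      also have "?a \<bullet> (u - z) \<le> (c + 1) * (\<kappa> * p u + e * t)"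
      proof -
        have "?a \<bullet> (u - z) \<le> norm ?a * norm (u - z)" by (rule norm_cauchy_schwarz)
        also have "\<dots> \<le> (c + 1) * (\<kappa> * p u + e * t)"
          using a z(2) ip c by (intro mult_mono) (auto simp: dist_norm)
        finally show ?thesis .
      qed
      finally have "t * (?a \<bullet> w) \<le> K * p u + t * (e * C)"
        by (simp add: K_def C_def algebra_simps)
      then have "?a \<bullet> w \<le> (K * p u + t * (e * C)) / t" using t by (simp add: pos_le_divide_eq mult.commute)
      also have "\<dots> = K * (p u / t) + e * C" using t by (simp add: add_divide_distrib)
      finally show ?thesis by (simp add: u_def)
    qed
    have "eventually (\<lambda>t. ?a \<bullet> w \<le> K * (p (x + t *\<^sub>R w) / t) + e * C) (at_right 0)"
      unfolding eventually_at_right_field using b ev by blast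
    moreover have "((\<lambda>t. K * (p (x + t *\<^sub>R w) / t) + e * C) \<longlongrightarrow> K * ?q + e * C) (at_right 0)"
      by (intro tendsto_intros lim)
    ultimately show ?thesis by (intro tendsto_lowerbound[of _ _ "at_right 0"]) auto
  qed
  show ?thesis
  proof (rule field_le_epsilon)
    fix e :: real assume "e > 0"
    then have "0 < min 1 (e / C)" "min 1 (e / C) * C \<le> e" using C by (auto simp: min_def field_simps)
    with main[of "min 1 (e / C)"] show "?a \<bullet> w \<le> K * ?q + e" by simp
  qed
qed

text \<open>The bound in \<open>exact_penalty\<close> is the support function of a zonotope whose
  coefficients range over \<open>[0, K]\<close> for active inequalities, \<open>[-K, K]\<close> for
  equations and \<open>{0}\<close> for inactive inequalities. Sign conditions, boundedness and
  complementarity are thus all encoded in \<open>l\<close> and \<open>u\<close>.\<close>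

lemma bounded_multipliers:
  assumes x: "x \<in> ball xb \<delta>" and sub: "regular_subgradient \<Gamma> f x v" and v: "norm v \<le> 1"
  shows "\<exists>y\<in>mult_cone s. v = grad f x + (\<Sum>i=1..m. y i *\<^sub>R grad (\<phi> i) x) \<and>
     (\<forall>i\<in>{1..m}. \<bar>y i\<bar> \<le> K) \<and> (\<forall>i\<in>{1..m}. y i * \<phi> i x = 0)"
proof -
  define l where "l i = (if i \<le> s then 0 else - K)" for i
  define u where "u i = (if i \<le> s \<and> \<phi> i x \<noteq> 0 then 0 else K)" for i
  have x\<Gamma>: "x \<in> \<Gamma>" using sub by (simp add: regular_subgradient_def)
  have "\<exists>y. (\<forall>i\<in>{1..m}. l i \<le> y i \<and> y i \<le> u i) \<and> v - grad f x = (\<Sum>i\<in>{1..m}. y i *\<^sub>R grad (\<phi> i) x)"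
  proof (rule zonotope_membership)
    fix w
    show "(v - grad f x) \<bullet> w \<le> (\<Sum>i=1..m. max (l i * (grad (\<phi> i) x \<bullet> w)) (u i * (grad (\<phi> i) x \<bullet> w)))"
    proof (rule order_trans[OF exact_penalty[OF x sub v, of w]], unfold sum_distrib_left, rule sum_mono)
      fix i
      have "K * max g 0 = max 0 (K * g)" "K * \<bar>g\<bar> = max (- K * g) (K * g)" for g :: real
        using K by (auto simp: max_def abs_if mult_le_0_iff zero_le_mult_iff)
      then show "K * (if i \<le> s then if \<phi> i x = 0 then max (grad (\<phi> i) x \<bullet> w) 0 else 0 else \<bar>grad (\<phi> i) x \<bullet> w\<bar>)
         \<le> max (l i * (grad (\<phi> i) x \<bullet> w)) (u i * (grad (\<phi> i) x \<bullet> w))"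
        by (simp add: l_def u_def)
    qed
  qed (use K in \<open>auto simp: l_def u_def\<close>)
  then obtain y where y: "\<And>i. i \<in> {1..m} \<Longrightarrow> l i \<le> y i \<and> y i \<le> u i"
    "v - grad f x = (\<Sum>i\<in>{1..m}. y i *\<^sub>R grad (\<phi> i) x)" by blast
  have "y \<in> mult_cone s" using y(1) sm by (force simp: mult_cone_def l_def)
  moreover have "v = grad f x + (\<Sum>i=1..m. y i *\<^sub>R grad (\<phi> i) x)" using y(2) by (simp add: algebra_simps)
  moreover have "\<bar>y i\<bar> \<le> K" if "i \<in> {1..m}" for i
    using y(1)[OF that] K by (auto simp: l_def u_def split: if_splits)
  moreover have "y i * \<phi> i x = 0" if "i \<in> {1..m}" for i
    using y(1)[OF that] x\<Gamma> that by (auto simp: l_def u_def feas_def split: if_splits)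
  ultimately show ?thesis by blast
qed

end

text \<open>Frechet differentiability tolerates directions that vary with \<open>k\<close>; the
  points \<open>X k\<close> lie in the graph of a subdifferential and cannot be placed on a
  ray.\<close>

lemma sequential_directional_derivative:
  fixes F :: "'a::euclidean_space \<Rightarrow> 'b::real_normed_vector"
  assumes D: "(F has_derivative D) (at x)"
    and t: "\<And>k. 0 < t k" "t \<longlonglongrightarrow> 0" and w: "(\<lambda>k. (X k - x) /\<^sub>R t k) \<longlonglongrightarrow> w"
  shows "X \<longlonglongrightarrow> x" and "(\<lambda>k. (F (X k) - F x) /\<^sub>R t k) \<longlonglongrightarrow> D w"
proof -
  have "(\<lambda>k. x + t k *\<^sub>R ((X k - x) /\<^sub>R t k)) \<longlonglongrightarrow> x + 0 *\<^sub>R w"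
    by (intro tendsto_add tendsto_const tendsto_scaleR t w)
  moreover have "x + t k *\<^sub>R ((X k - x) /\<^sub>R t k) = X k" for k using t(1)[of k] by simp
  ultimately show X: "X \<longlonglongrightarrow> x" by simp
  \<comment> \<open>At \<open>y = x\<close> the value is \<open>0\<close> because
    \<open>inverse 0 = 0\<close>, so \<open>R (X k)\<close> tends to \<open>0\<close> even if some
    \<open>X k\<close> equal \<open>x\<close>.\<close>
  define R where "R y = (F y - F x - D (y - x)) /\<^sub>R norm (y - x)" for y
  have "(R \<longlongrightarrow> R x) (at x)"
    using D unfolding has_derivative_at_within R_def by simp
  then have "(R \<longlongrightarrow> R x) (nhds x)" by (simp add: tendsto_at_iff_tendsto_nhds)
  then have R: "(\<lambda>k. R (X k)) \<longlonglongrightarrow> 0" using filterlim_compose[OF _ X, of R] by (simp add: R_def)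
  have lin: "bounded_linear D" using D by (rule has_derivative_bounded_linear)
  interpret D: bounded_linear D by (fact lin)
  have "(\<lambda>k. D ((X k - x) /\<^sub>R t k) + norm ((X k - x) /\<^sub>R t k) *\<^sub>R R (X k)) \<longlonglongrightarrow> D w + norm w *\<^sub>R 0"
    by (intro tendsto_add tendsto_scaleR tendsto_norm D.tendsto w R)
  moreover have "D ((X k - x) /\<^sub>R t k) + norm ((X k - x) /\<^sub>R t k) *\<^sub>R R (X k) = (F (X k) - F x) /\<^sub>R t k" for k
  proof (cases "X k = x")
    case False
    then have "norm (X k - x) *\<^sub>R R (X k) = F (X k) - F x - D (X k - x)" by (simp add: R_def)
    moreover have "norm ((X k - x) /\<^sub>R t k) *\<^sub>R R (X k) = (norm (X k - x) *\<^sub>R R (X k)) /\<^sub>R t k"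
      using t(1)[of k] by simp
    moreover have "D ((X k - x) /\<^sub>R t k) = D (X k - x) /\<^sub>R t k" by (rule D.scaleR)
    ultimately have "D ((X k - x) /\<^sub>R t k) + norm ((X k - x) /\<^sub>R t k) *\<^sub>R R (X k)
        = D (X k - x) /\<^sub>R t k + (F (X k) - F x - D (X k - x)) /\<^sub>R t k" by (simp only:)
    then show ?thesis by (simp flip: scaleR_add_right)
  qed (simp add: D.zero)
  ultimately show "(\<lambda>k. (F (X k) - F x) /\<^sub>R t k) \<longlonglongrightarrow> D w" by simp
qed

lemma bounded_family_convergent_subsequence:
  fixes Y :: "nat \<Rightarrow> 'i \<Rightarrow> real"
  assumes "finite I" "\<And>k i. i \<in> I \<Longrightarrow> \<bar>Y k i\<bar> \<le> B"
  shows "\<exists>r y. strict_mono (r :: nat \<Rightarrow> nat) \<and> (\<forall>i\<in>I. (\<lambda>k. Y (r k) i) \<longlonglongrightarrow> y i)"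
  using assms
proof (induction I)
  case empty
  show ?case by (intro exI[of _ "\<lambda>k. k"]) (auto simp: strict_mono_def)
next
  case (insert j I)
  obtain r y where r: "strict_mono r" "\<And>i. i \<in> I \<Longrightarrow> (\<lambda>k. Y (r k) i) \<longlonglongrightarrow> y i"
    using insert.IH insert.prems by blast
  have "\<forall>k. Y (r k) j \<in> {-B..B}"
    using insert.prems[of j] by (auto simp: abs_le_iff minus_le_iff)
  then have "\<exists>l\<in>{-B..B}. \<exists>r'. strict_mono r' \<and> ((\<lambda>k. Y (r k) j) \<circ> r') \<longlonglongrightarrow> l"
    using spec[OF compact_Icc[of "-B" B, unfolded compact_def], of "\<lambda>k. Y (r k) j"] by (rule mp[rotated])
  then obtain l r' where r': "strict_mono r'" "((\<lambda>k. Y (r k) j) \<circ> r') \<longlonglongrightarrow> l" by blast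
  show ?case
  proof (intro exI[of _ "r \<circ> r'"] exI[of _ "y(j := l)"] conjI ballI)
    show "strict_mono (r \<circ> r')" using r(1) r'(1) by (rule strict_mono_o)
    fix i assume i: "i \<in> insert j I"
    show "(\<lambda>k. Y ((r \<circ> r') k) i) \<longlonglongrightarrow> (y(j := l)) i"
    proof (cases "i = j")
      case False
      then have "(\<lambda>k. Y (r k) i) \<longlonglongrightarrow> y i" using i r(2) by simp
      from LIMSEQ_subseq_LIMSEQ[OF this r'(1)] False show ?thesis by (simp add: o_def)
    qed (use r'(2) in \<open>simp add: o_def\<close>)
  qed
qed

section \<open>The Lagrangian and limits of multipliers\<close>

context nlp
begin

lemma multiplier_pairing_nonpos:
  assumes "y \<in> mult_cone s" "u \<in> \<Gamma>"
  shows "ypair \<phi> m y u \<le> 0"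
  unfolding ypair_def
proof (rule sum_nonpos)
  fix i assume "i \<in> {1..m}"
  then show "y i * \<phi> i u \<le> 0"
    using assms by (cases "i \<le> s") (auto simp: mult_cone_def feas_def mult_nonneg_nonpos)
qed

lemma complementarity_iff:
  assumes "y \<in> mult_cone s" "u \<in> \<Gamma>"
  shows "ypair \<phi> m y u = 0 \<longleftrightarrow> (\<forall>i\<in>{1..m}. y i * \<phi> i u = 0)"
proof -
  have "- (y i * \<phi> i u) \<ge> 0" if "i \<in> {1..m}" for i
    using assms that by (cases "i \<le> s") (auto simp: mult_cone_def feas_def mult_nonneg_nonpos)
  then have "(\<Sum>i=1..m. - (y i * \<phi> i u)) = 0 \<longleftrightarrow> (\<forall>i\<in>{1..m}. - (y i * \<phi> i u) = 0)"
    by (intro sum_nonneg_eq_0_iff) auto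
  then show ?thesis by (simp add: ypair_def sum_negf)
qed

lemma has_derivative_ypair:
  assumes "x \<in> ball xb \<delta>"
  shows "(ypair \<phi> m y has_derivative (\<lambda>h. (\<Sum>i=1..m. y i *\<^sub>R grad (\<phi> i) x) \<bullet> h)) (at x)"
proof -
  have "((\<lambda>x. \<Sum>i=1..m. y i * \<phi> i x) has_derivative (\<lambda>h. \<Sum>i=1..m. y i * (grad (\<phi> i) x \<bullet> h))) (at x)"
    by (intro has_derivative_sum has_derivative_mult_right C2_boundD(1)[OF \<phi>_bound assms])
  then show ?thesis by (simp add: ypair_def[abs_def] inner_sum_left)
qed

lemma grad_ypair:
  assumes "x \<in> ball xb \<delta>"
  shows "grad (ypair \<phi> m y) x = (\<Sum>i=1..m. y i *\<^sub>R grad (\<phi> i) x)"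
  using has_derivative_ypair[OF assms] by (rule grad_eqI)

lemma grad_Lag:
  assumes "x \<in> ball xb \<delta>"
  shows "grad (\<lambda>z. Lag f \<phi> m z y) x = grad f x + (\<Sum>i=1..m. y i *\<^sub>R grad (\<phi> i) x)"
proof (rule grad_eqI)
  show "((\<lambda>z. Lag f \<phi> m z y) has_derivative
      (\<lambda>h. (grad f x + (\<Sum>i=1..m. y i *\<^sub>R grad (\<phi> i) x)) \<bullet> h)) (at x)"
    unfolding Lag_def inner_add_left
    by (intro has_derivative_add C2_boundD(1)[OF f_bound assms] has_derivative_ypair[OF assms])
qed

lemma hess_ypair:
  assumes x: "x \<in> ball xb \<delta>"
  shows "hess (ypair \<phi> m y) x w = (\<Sum>i=1..m. y i *\<^sub>R hess (\<phi> i) x w)"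
proof -
  have "((\<lambda>x. \<Sum>i=1..m. y i *\<^sub>R grad (\<phi> i) x) has_derivative (\<lambda>h. \<Sum>i=1..m. y i *\<^sub>R hess (\<phi> i) x h)) (at x)"
    by (intro has_derivative_sum has_derivative_scaleR_right C2_boundD(2)[OF \<phi>_bound x])
  then have "(grad (ypair \<phi> m y) has_derivative (\<lambda>h. \<Sum>i=1..m. y i *\<^sub>R hess (\<phi> i) x h)) (at x)"
    by (rule has_derivative_transform_within_open[OF _ open_ball x]) (simp add: grad_ypair)
  then have "frechet_derivative (grad (ypair \<phi> m y)) (at x) = (\<lambda>h. \<Sum>i=1..m. y i *\<^sub>R hess (\<phi> i) x h)"
    by (rule frechet_derivative_at[symmetric])
  then show ?thesis by (simp add: hess_def)
qed

text \<open>On \<open>\<Gamma>\<close> the Lagrangian lies below \<open>f\<close> by the signs of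
  the multipliers, and at \<open>x\<close> it equals \<open>f\<close> by complementarity, so its
  Taylor bound passes to \<open>f\<close>. The curvature constant grows with \<open>y\<close>; a
  uniform one requires bounded multipliers.\<close>

lemma lagrangian_minorant:
  assumes x: "x \<in> ball xb \<delta>" and u: "u \<in> ball xb \<delta>" "u \<in> \<Gamma>"
    and y: "y \<in> mult_cone s" "ypair \<phi> m y x = 0"
  shows "f x + (grad f x + (\<Sum>i=1..m. y i *\<^sub>R grad (\<phi> i) x)) \<bullet> (u - x)
     - (c + (\<Sum>i=1..m. \<bar>y i\<bar> * c)) * (norm (u - x))\<^sup>2 \<le> f u"
proof -
  have "f x + grad f x \<bullet> (u - x) - c * (norm (u - x))\<^sup>2 \<le> f u"
    using C2_boundD(4)[OF f_bound x u(1)] by linarith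
  moreover have "(\<Sum>i=1..m. y i * \<phi> i x + y i * (grad (\<phi> i) x \<bullet> (u - x)) - \<bar>y i\<bar> * c * (norm (u - x))\<^sup>2)
      \<le> (\<Sum>i=1..m. y i * \<phi> i u)"
  proof (rule sum_mono)
    fix i assume i: "i \<in> {1..m}"
    have "\<bar>y i * (\<phi> i u - \<phi> i x - grad (\<phi> i) x \<bullet> (u - x))\<bar> \<le> \<bar>y i\<bar> * (c * (norm (u - x))\<^sup>2)"
      unfolding abs_mult using C2_boundD(4)[OF \<phi>_bound[OF i] x u(1)] by (intro mult_left_mono) auto
    moreover have "y i * (\<phi> i u - \<phi> i x - grad (\<phi> i) x \<bullet> (u - x))
        = y i * \<phi> i u - y i * \<phi> i x - y i * (grad (\<phi> i) x \<bullet> (u - x))"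
      by (simp only: right_diff_distrib)
    ultimately show "y i * \<phi> i x + y i * (grad (\<phi> i) x \<bullet> (u - x)) - \<bar>y i\<bar> * c * (norm (u - x))\<^sup>2 \<le> y i * \<phi> i u"
      by (simp only: mult.assoc)
  qed
  moreover have "(\<Sum>i=1..m. y i * \<phi> i u) \<le> 0"
    using multiplier_pairing_nonpos[OF y(1) u(2)] by (simp add: ypair_def)
  ultimately show ?thesis
    using y(2) by (simp add: ypair_def sum.distrib sum_subtractf inner_add_left inner_sum_left
        sum_distrib_right distrib_right)
qed

lemma stationary_imp_regular_subgradient:
  assumes "xb \<in> \<Gamma>" "y \<in> mult_cone s" "ypair \<phi> m y xb = 0" "grad (\<lambda>z. Lag f \<phi> m z y) xb = 0"
  shows "regular_subgradient \<Gamma> f xb 0"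
proof (rule regular_subgradient_of_quadratic_minorant[OF assms(1) \<delta>])
  fix u assume "u \<in> \<Gamma>" "u \<in> ball xb \<delta>"
  moreover have "xb \<in> ball xb \<delta>" using \<delta> by simp
  ultimately show "f xb + 0 \<bullet> (u - xb) - (c + (\<Sum>i=1..m. \<bar>y i\<bar> * c)) * (norm (u - xb))\<^sup>2 \<le> f u"
    using lagrangian_minorant[of xb u y] assms grad_Lag[of xb y] by simp
qed

lemma compact_feasible:
  assumes "\<rho> < \<delta>"
  shows "compact (\<Gamma> \<inter> cball xb \<rho>)"
proof -
  have sub: "cball xb \<rho> \<subseteq> ball xb \<delta>" using assms by auto
  have c: "continuous_on (cball xb \<rho>) (\<phi> i)" if "i \<in> {1..m}" for i
    using C2_boundD(1)[OF \<phi>_bound[OF that]] sub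
    by (intro continuous_at_imp_continuous_on ballI has_derivative_continuous) blast
  have "closed (cball xb \<rho> \<inter> (\<Inter>i\<in>{1..s}. {x \<in> cball xb \<rho>. \<phi> i x \<le> 0}) \<inter> (\<Inter>i\<in>{s+1..m}. {x \<in> cball xb \<rho>. \<phi> i x = 0}))"
    by (intro closed_Int closed_INT ballI closed_cball continuous_on_closed_Collect_le
        continuous_closed_preimage_constant c continuous_on_const) (use sm in auto)
  moreover have "cball xb \<rho> \<inter> (\<Inter>i\<in>{1..s}. {x \<in> cball xb \<rho>. \<phi> i x \<le> 0}) \<inter> (\<Inter>i\<in>{s+1..m}. {x \<in> cball xb \<rho>. \<phi> i x = 0})
      = \<Gamma> \<inter> cball xb \<rho>"
    by (auto simp: feas_def)
  ultimately show ?thesis by (simp add: compact_eq_bounded_closed bounded_Int)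
qed

text \<open>Twice the curvature constant of \<open>lagrangian_minorant\<close> with every multiplier
  at its bound \<open>K\<close>; the factor 2 matches the \<open>r / 2\<close> of
  \<open>prox_regular\<close>.\<close>

definition R where "R = 2 * (c + real m * (K * c))"

lemma prox_regular:
  assumes "xb \<in> \<Gamma>" "regular_subgradient \<Gamma> f xb 0" and \<rho>: "0 < \<rho>" "\<rho> < \<delta>" "\<rho> \<le> 1"
  shows "prox_regular \<Gamma> f xb \<rho> R"
proof
  show "0 < R" using c K by (simp add: R_def add_pos_nonneg)
  show "compact (\<Gamma> \<inter> cball xb \<rho>)" using \<rho> by (intro compact_feasible)
  show "continuous_on (\<Gamma> \<inter> cball xb \<rho>) f"
    using \<rho>
    by (intro continuous_at_imp_continuous_on ballI has_derivative_continuous[OF C2_boundD(1)[OF f_bound]]) auto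
  fix x v u
  assume sub: "regular_subgradient \<Gamma> f x v" and "norm (x - xb) < \<rho>" "norm v < \<rho>"
    and u: "u \<in> \<Gamma>" "norm (u - xb) \<le> \<rho>"
  then have x: "x \<in> ball xb \<delta>" "u \<in> ball xb \<delta>" "norm v \<le> 1" "x \<in> \<Gamma>"
    using \<rho> by (auto simp: dist_norm norm_minus_commute regular_subgradient_def)
  obtain y where y: "y \<in> mult_cone s" "v = grad f x + (\<Sum>i=1..m. y i *\<^sub>R grad (\<phi> i) x)"
     "\<And>i. i\<in>{1..m} \<Longrightarrow> \<bar>y i\<bar> \<le> K" "\<forall>i\<in>{1..m}. y i * \<phi> i x = 0"
    using bounded_multipliers[OF x(1) sub x(3)] by blast
  have "(\<Sum>i=1..m. \<bar>y i\<bar> * c) \<le> (\<Sum>i=1..m. K * c)"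
    using y(3) c by (intro sum_mono mult_right_mono) auto
  then have "(c + (\<Sum>i=1..m. \<bar>y i\<bar> * c)) * (norm (u - x))\<^sup>2 \<le> R / 2 * (norm (u - x))\<^sup>2"
    by (intro mult_right_mono) (auto simp: R_def)
  moreover have "ypair \<phi> m y x = 0" using complementarity_iff[OF y(1) x(4)] y(4) by simp
  ultimately show "f x + v \<bullet> (u - x) - R / 2 * (norm (u - x))\<^sup>2 \<le> f u"
    using lagrangian_minorant[OF x(1,2) u(1) y(1)] y(2) by simp
qed (use assms in auto)

text \<open>The multipliers along the sequence are bounded, so a subsequence converges to a
  multiplier \<open>y\<close> of \<open>v\<close> at \<open>x\<close>, where the second-order
  condition is applied. The quotients \<open>(Y k - y) / t k\<close> may be unbounded, so their
  share of \<open>q . w\<close> is estimated from below instead of being passed to a limit.\<close>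

lemma infinitesimal_monotonicity:
  assumes second_order: "\<And>x y w. \<lbrakk>x \<in> ball xb \<rho>; y \<in> mult_cone s; grad (\<lambda>z. Lag f \<phi> m z y) x \<in> ball 0 \<rho>;
      ypair \<phi> m y x = 0; w \<in> Scone \<phi> s m x y\<rbrakk> \<Longrightarrow>
      \<sigma> * (norm w)\<^sup>2 \<le> hess f x w \<bullet> w + w \<bullet> hess (ypair \<phi> m y) x w"
    and \<rho>: "\<rho> < \<delta>" "\<rho> \<le> 1"
    and sub: "regular_subgradient \<Gamma> f x v" and xv: "norm (x - xb) < \<rho>" "norm v < \<rho>"
    and subk: "\<And>k. regular_subgradient \<Gamma> f (X0 k) (V0 k)"
    and XVk: "\<And>k::nat. norm (X0 k - xb) < \<rho>" "\<And>k. norm (V0 k) < \<rho>"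
    and t0: "\<And>k. 0 < t0 k" "t0 \<longlonglongrightarrow> 0"
    and lim0: "(\<lambda>k. (X0 k - x) /\<^sub>R t0 k) \<longlonglongrightarrow> w" "(\<lambda>k. (V0 k - v) /\<^sub>R t0 k) \<longlonglongrightarrow> q"
  shows "\<sigma> * (norm w)\<^sup>2 \<le> q \<bullet> w"
proof -
  have x: "x \<in> ball xb \<delta>" "x \<in> ball xb \<rho>" "x \<in> \<Gamma>"
    using xv \<rho> sub by (auto simp: dist_norm norm_minus_commute regular_subgradient_def)
  have X0: "X0 k \<in> ball xb \<delta>" "norm (V0 k) \<le> 1" "X0 k \<in> \<Gamma>" for k
    using XVk[of k] \<rho> subk[of k] by (auto simp: dist_norm norm_minus_commute regular_subgradient_def)
  have "\<exists>y. y \<in> mult_cone s \<and> V0 k = grad f (X0 k) + (\<Sum>i=1..m. y i *\<^sub>R grad (\<phi> i) (X0 k)) \<and>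
     (\<forall>i\<in>{1..m}. \<bar>y i\<bar> \<le> K) \<and> (\<forall>i\<in>{1..m}. y i * \<phi> i (X0 k) = 0)" for k
    using bounded_multipliers[OF X0(1) subk X0(2), of k] by blast
  then obtain Y0 where Y0: "\<And>k. Y0 k \<in> mult_cone s"
     "\<And>k. V0 k = grad f (X0 k) + (\<Sum>i=1..m. Y0 k i *\<^sub>R grad (\<phi> i) (X0 k))"
     "\<And>k i. i\<in>{1..m} \<Longrightarrow> \<bar>Y0 k i\<bar> \<le> K" "\<And>k i. i\<in>{1..m} \<Longrightarrow> Y0 k i * \<phi> i (X0 k) = 0"
    by metis
  obtain r y where r: "strict_mono r" and y: "\<And>i. i \<in> {1..m} \<Longrightarrow> (\<lambda>k. Y0 (r k) i) \<longlonglongrightarrow> y i"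
    using bounded_family_convergent_subsequence[of "{1..m}" Y0 K] Y0(3) by blast
  define X V Y t where "X k = X0 (r k)" and "V k = V0 (r k)" and "Y k = Y0 (r k)" and "t k = t0 (r k)" for k
  define W where "W k = (X k - x) /\<^sub>R t k" for k
  have tp: "t k > 0" for k using t0 by (simp add: t_def)
  have tl: "t \<longlonglongrightarrow> 0" using LIMSEQ_subseq_LIMSEQ[OF t0(2) r] by (simp add: t_def[abs_def] o_def)
  have Wl': "(\<lambda>k. (X k - x) /\<^sub>R t k) \<longlonglongrightarrow> w"
    using LIMSEQ_subseq_LIMSEQ[OF lim0(1) r] by (simp add: X_def t_def o_def)
  then have Wl: "W \<longlonglongrightarrow> w" by (simp add: W_def[abs_def])
  have Vl: "(\<lambda>k. (V k - v) /\<^sub>R t k) \<longlonglongrightarrow> q"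
    using LIMSEQ_subseq_LIMSEQ[OF lim0(2) r] by (simp add: V_def t_def o_def)
  note der = sequential_directional_derivative[OF _ tp tl Wl']
  have Vv: "V \<longlonglongrightarrow> v" by (rule sequential_directional_derivative(1)[OF has_derivative_ident tp tl Vl])
  have Yl: "(\<lambda>k. Y k i) \<longlonglongrightarrow> y i" if "i \<in> {1..m}" for i using y[OF that] by (simp add: Y_def)
  have Xl: "X \<longlonglongrightarrow> x" by (rule der(1)[OF has_derivative_ident])
  have Xb: "X k \<in> ball xb \<delta>" "X k \<in> \<Gamma>" for k using X0 by (auto simp: X_def)
  have Ys: "Y k \<in> mult_cone s" for k using Y0 by (simp add: Y_def)
  have YV: "V k = grad f (X k) + (\<Sum>i=1..m. Y k i *\<^sub>R grad (\<phi> i) (X k))" for k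
    using Y0(2) by (simp add: X_def V_def Y_def)
  have Yc: "Y k i * \<phi> i (X k) = 0" if "i \<in> {1..m}" for k i using Y0(4)[OF that] by (simp add: X_def Y_def)
  have cont: "(\<lambda>k. h (X k)) \<longlonglongrightarrow> h x" if "(h has_derivative D) (at x)"
    for h :: "'a \<Rightarrow> 'c::real_normed_vector" and D
    using isCont_tendsto_compose[OF has_derivative_continuous[OF that] Xl] .
  note fd = C2_boundD(1,2)[OF f_bound x(1)]
  note pd = C2_boundD(1,2)[OF \<phi>_bound x(1)]
  have y_cone: "y \<in> mult_cone s"
    unfolding mult_cone_def
  proof (intro CollectI ballI)
    fix i assume i: "i \<in> {1..s}"
    then have im: "i \<in> {1..m}" using sm by auto
    show "0 \<le> y i"
      using Yl[OF im] by (rule LIMSEQ_le_const) (use Ys i in \<open>auto simp: mult_cone_def\<close>)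
  qed
  have y_compl: "y i * \<phi> i x = 0" if i: "i \<in> {1..m}" for i
  proof -
    have "(\<lambda>k. Y k i * \<phi> i (X k)) \<longlonglongrightarrow> y i * \<phi> i x"
      by (intro tendsto_mult Yl[OF i] cont[OF pd(1)[OF i]])
    then show ?thesis using Yc[OF i] LIMSEQ_const_iff by (simp add: LIMSEQ_const_iff)
  qed
  have pair0: "ypair \<phi> m y x = 0" using complementarity_iff[OF y_cone x(3)] y_compl by simp
  have "V \<longlonglongrightarrow> grad f x + (\<Sum>i=1..m. y i *\<^sub>R grad (\<phi> i) x)"
    unfolding YV[abs_def]
    by (intro tendsto_add tendsto_sum tendsto_scaleR Yl cont[OF fd(2)] cont[OF pd(2)])
  then have v: "v = grad f x + (\<Sum>i=1..m. y i *\<^sub>R grad (\<phi> i) x)"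
    using LIMSEQ_unique[OF Vv] by blast
  have quot: "(\<lambda>k. (\<phi> i (X k) - \<phi> i x) / t k) \<longlonglongrightarrow> grad (\<phi> i) x \<bullet> w" if i: "i \<in> {1..m}" for i
    using der(2)[OF pd(1)[OF i]] by (simp add: divide_inverse_commute)
  have tangent: "grad (\<phi> i) x \<bullet> w \<le> 0" if i: "i \<in> {1..m}" and "\<phi> i x = 0" for i
  proof (rule LIMSEQ_le_const2[OF quot[OF i]])
    have "\<phi> i (X k) \<le> 0" for k
      using Xb(2)[of k] i by (cases "i \<le> s") (auto simp: feas_def)
    then show "\<exists>N. \<forall>k\<ge>N. (\<phi> i (X k) - \<phi> i x) / t k \<le> 0"
      using tp that(2) by (auto simp: divide_nonpos_pos)
  qed
  \<comment> \<open>A positive limit multiplier is positive along a tail of the sequence, so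
    complementarity keeps constraint \<open>i\<close> active at \<open>X k\<close> as well as at
    \<open>x\<close>.\<close>
  have tangent_eq: "grad (\<phi> i) x \<bullet> w = 0" if i: "i \<in> {1..m}" and *: "s < i \<or> 0 < y i" for i
  proof -
    have "eventually (\<lambda>k. (\<phi> i (X k) - \<phi> i x) / t k = 0) sequentially"
      using *
    proof
      assume "s < i"
      then have "\<phi> i x = 0" "\<phi> i (X k) = 0" for k using x(3) Xb(2)[of k] i by (auto simp: feas_def)
      then show ?thesis by simp
    next
      assume p: "0 < y i"
      then have "\<phi> i x = 0" using y_compl[OF i] by simp
      moreover have "eventually (\<lambda>k. 0 < Y k i) sequentially" using Yl[OF i] p by (rule order_tendstoD)
      ultimately show ?thesis by (auto elim!: eventually_mono) (use Yc[OF i] in \<open>metis less_irrefl mult_eq_0_iff\<close>)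
    qed
    then have "(\<lambda>k. (\<phi> i (X k) - \<phi> i x) / t k) \<longlonglongrightarrow> 0" by (rule tendsto_eventually)
    then show ?thesis using LIMSEQ_unique[OF quot[OF i]] by blast
  qed
  define Q where "Q = hess f x w \<bullet> w + (\<Sum>i=1..m. y i * (hess (\<phi> i) x w \<bullet> w))"
  \<comment> \<open>\<open>Scone\<close> is the negative of the critical cone, in which \<open>w\<close> lies.\<close>
  have "- w \<in> Scone \<phi> s m x y"
    unfolding Scone_def active_def active_plus_def
    using sm tangent tangent_eq by (auto simp: not_less)
  then have "\<sigma> * (norm (- w))\<^sup>2 \<le> hess f x (- w) \<bullet> (- w) + (- w) \<bullet> hess (ypair \<phi> m y) x (- w)"
    using x(2) y_cone pair0 v xv(2) grad_Lag[OF x(1), of y] by (intro second_order) auto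
  moreover have "hess f x (- w) = - hess f x w"
    using has_derivative_linear[OF fd(2)] by (rule linear_neg)
  moreover have "hess (\<phi> i) x (- w) = - hess (\<phi> i) x w" if "i \<in> {1..m}" for i
    using has_derivative_linear[OF pd(2)[OF that]] by (rule linear_neg)
  ultimately have "\<sigma> * (norm w)\<^sup>2 \<le> Q"
    by (simp add: hess_ypair[OF x(1)] Q_def inner_sum_right sum_negf inner_commute)
  also have "Q \<le> q \<bullet> w"
  proof (rule LIMSEQ_le)
    \<comment> \<open>The last sum is the error from the varying multipliers; it vanishes in the
      limit because \<open>norm (W k)\<close> converges and \<open>Y k i\<close> tends to
      \<open>y i\<close>.\<close>
    let ?a = "\<lambda>k. ((grad f (X k) - grad f x) /\<^sub>R t k) \<bullet> W k
      + (\<Sum>i=1..m. Y k i * (((grad (\<phi> i) (X k) - grad (\<phi> i) x) /\<^sub>R t k) \<bullet> W k))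
      - (\<Sum>i=1..m. \<bar>Y k i - y i\<bar> * (c * (norm (W k))\<^sup>2))"
    have "?a \<longlonglongrightarrow> hess f x w \<bullet> w + (\<Sum>i=1..m. y i * (hess (\<phi> i) x w \<bullet> w))
        - (\<Sum>i=1..m. \<bar>y i - y i\<bar> * (c * (norm w)\<^sup>2))"
      by (intro tendsto_add tendsto_diff tendsto_sum tendsto_mult tendsto_inner tendsto_rabs tendsto_power
          tendsto_norm tendsto_const Yl Wl der(2)[OF fd(2)] der(2)[OF pd(2)])
    then show "?a \<longlonglongrightarrow> Q" by (simp add: Q_def)
    show "(\<lambda>k. ((V k - v) /\<^sub>R t k) \<bullet> W k) \<longlonglongrightarrow> q \<bullet> w" by (intro tendsto_inner Vl Wl)
    have "?a k \<le> ((V k - v) /\<^sub>R t k) \<bullet> W k" for k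
    proof -
      have key: "- (\<bar>Y k i - y i\<bar> * (c * (norm (W k))\<^sup>2)) \<le> (Y k i - y i) * ((grad (\<phi> i) x /\<^sub>R t k) \<bullet> W k)"
        if i: "i \<in> {1..m}" for i
      proof -
        define e where "e = \<phi> i (X k) - \<phi> i x - grad (\<phi> i) x \<bullet> (X k - x)"
        have XW: "X k - x = t k *\<^sub>R W k" using tp[of k] by (simp add: W_def)
        have "\<bar>e\<bar> \<le> c * (norm (X k - x))\<^sup>2"
          unfolding e_def by (rule C2_boundD(4)[OF \<phi>_bound[OF i] x(1) Xb(1)])
        also have "\<dots> = (t k)\<^sup>2 * (c * (norm (W k))\<^sup>2)"
          unfolding XW by (simp add: power_mult_distrib)
        finally have e: "\<bar>(Y k i - y i) * e\<bar> \<le> \<bar>Y k i - y i\<bar> * ((t k)\<^sup>2 * (c * (norm (W k))\<^sup>2))"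
          unfolding abs_mult by (intro mult_left_mono) auto
        \<comment> \<open>Complementarity makes \<open>(Y k i - y i) * (\<phi> i (X k) - \<phi> i x)\<close> nonnegative, so the multiplier
          variation contributes only through the curvature error \<open>e\<close>, which is multiplied by
          \<open>Y k i - y i \<longlonglongrightarrow> 0\<close>.\<close>
        have "0 \<le> - Y k i * \<phi> i x - y i * \<phi> i (X k)"
        proof (cases "i \<le> s")
          case True
          then have "Y k i * \<phi> i x \<le> 0" "y i * \<phi> i (X k) \<le> 0"
            using i x(3) Xb(2)[of k] Ys[of k] y_cone
            by (auto simp: mult_cone_def feas_def intro!: mult_nonneg_nonpos)
          then show ?thesis by simp
        next
          case False
          then have "\<phi> i x = 0" "\<phi> i (X k) = 0" using i x(3) Xb(2)[of k] by (auto simp: feas_def)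
          then show ?thesis by simp
        qed
        also have "\<dots> = (Y k i - y i) * (\<phi> i (X k) - \<phi> i x)"
          by (simp only: left_diff_distrib right_diff_distrib Yc[OF i] y_compl[OF i])
        also have "\<dots> = (Y k i - y i) * e + (Y k i - y i) * (grad (\<phi> i) x \<bullet> (X k - x))"
          by (simp add: e_def algebra_simps)
        finally have "- (\<bar>Y k i - y i\<bar> * ((t k)\<^sup>2 * (c * (norm (W k))\<^sup>2))) \<le> (Y k i - y i) * (grad (\<phi> i) x \<bullet> (X k - x))"
          using e by linarith
        moreover have "(t k)\<^sup>2 * ((Y k i - y i) * ((grad (\<phi> i) x /\<^sub>R t k) \<bullet> W k))
            = (Y k i - y i) * (grad (\<phi> i) x \<bullet> (X k - x))"
          unfolding XW using tp[of k] by (simp add: power2_eq_square)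
        moreover have "(t k)\<^sup>2 * - (\<bar>Y k i - y i\<bar> * (c * (norm (W k))\<^sup>2))
            = - (\<bar>Y k i - y i\<bar> * ((t k)\<^sup>2 * (c * (norm (W k))\<^sup>2)))"
          by (simp add: mult_ac)
        ultimately have "(t k)\<^sup>2 * - (\<bar>Y k i - y i\<bar> * (c * (norm (W k))\<^sup>2))
            \<le> (t k)\<^sup>2 * ((Y k i - y i) * ((grad (\<phi> i) x /\<^sub>R t k) \<bullet> W k))"
          by (simp only:)
        then show ?thesis using tp[of k] by (simp only: mult_le_cancel_left_pos zero_less_power)
      qed
      \<comment> \<open>With \<open>Y k\<close> as weights of the gradient differences, these
        quotients converge to the Hessian terms of \<open>Q\<close>. The multiplier variation
        remains at the fixed gradients at \<open>x\<close>, where \<open>key\<close>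
        applies.\<close>
      have "V k - v = (grad f (X k) - grad f x) + (\<Sum>i=1..m. Y k i *\<^sub>R (grad (\<phi> i) (X k) - grad (\<phi> i) x))
          + (\<Sum>i=1..m. (Y k i - y i) *\<^sub>R grad (\<phi> i) x)"
        unfolding YV v by (simp add: scaleR_diff_right scaleR_diff_left sum_subtractf)
      then have "((V k - v) /\<^sub>R t k) \<bullet> W k = ((grad f (X k) - grad f x) /\<^sub>R t k) \<bullet> W k
        + (\<Sum>i=1..m. Y k i * (((grad (\<phi> i) (X k) - grad (\<phi> i) x) /\<^sub>R t k) \<bullet> W k))
        + (\<Sum>i=1..m. (Y k i - y i) * ((grad (\<phi> i) x /\<^sub>R t k) \<bullet> W k))"
        by (simp add: inner_add_left inner_sum_left sum_distrib_left distrib_left mult_ac)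
      moreover have "- (\<Sum>i=1..m. \<bar>Y k i - y i\<bar> * (c * (norm (W k))\<^sup>2))
          \<le> (\<Sum>i=1..m. (Y k i - y i) * ((grad (\<phi> i) x /\<^sub>R t k) \<bullet> W k))"
        unfolding sum_negf[symmetric] using key by (rule sum_mono)
      ultimately show ?thesis by linarith
    qed
    then show "\<exists>N. \<forall>k\<ge>N. ?a k \<le> ((V k - v) /\<^sub>R t k) \<bullet> W k" by blast
  qed
  finally show ?thesis .
qed

end

section \<open>Variational convexity and tilt stability\<close>

definition extension :: "'a set \<Rightarrow> ('a \<Rightarrow> real) \<Rightarrow> 'a \<Rightarrow> ereal" where
  "extension \<Gamma> f x = (if x \<in> \<Gamma> then ereal (f x) else \<infinity>)"

lemma frechet_subdiff_extension:
  "v \<in> frechet_subdiff (extension \<Gamma> f) x \<longleftrightarrow> regular_subgradient \<Gamma> f x v"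
proof (cases "x \<in> \<Gamma>")
  case True
  have "(\<forall>u\<in>ball x d. extension \<Gamma> f x + ereal (v \<bullet> (u - x) - e * norm (u - x)) \<le> extension \<Gamma> f u) \<longleftrightarrow>
    (\<forall>u\<in>\<Gamma> \<inter> ball x d. f x + v \<bullet> (u - x) - e * norm (u - x) \<le> f u)" for e d
    using True by (auto simp: extension_def algebra_simps)
  then show ?thesis
    using True by (auto simp: frechet_subdiff_def regular_subgradient_def extension_def)
qed (simp add: frechet_subdiff_def regular_subgradient_def extension_def)

lemma convex_combination_norm_sq:
  fixes x y :: "'a::real_inner"
  shows "(norm ((1 - t) *\<^sub>R x + t *\<^sub>R y))\<^sup>2 = (1 - t) * (norm x)\<^sup>2 + t * (norm y)\<^sup>2 - t * (1 - t) * (norm (x - y))\<^sup>2"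
  unfolding power2_norm_eq_inner
  by (simp add: inner_add inner_diff inner_commute) (simp add: algebra_simps)

lemma frechet_subdiff_convex:
  fixes \<psi> :: "'a::euclidean_space \<Rightarrow> real"
  assumes \<psi>: "convex_on UNIV \<psi>" and v: "v \<in> frechet_subdiff (\<lambda>u. ereal (\<psi> u)) x"
  shows "\<psi> x + v \<bullet> (u - x) \<le> \<psi> u"
proof (rule field_le_epsilon)
  fix e :: real assume e: "e > 0"
  define e' where "e' = e / (norm (u - x) + 1)"
  have e': "e' > 0" "e' * norm (u - x) \<le> e"
    using e by (auto simp: e'_def add_nonneg_pos pos_divide_le_eq intro!: mult_left_mono)
  obtain d where d: "d > 0" "\<And>z. z \<in> ball x d \<Longrightarrow> \<psi> x + v \<bullet> (z - x) - e' * norm (z - x) \<le> \<psi> z"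
    using v e'(1) unfolding frechet_subdiff_def by (auto simp: algebra_simps)
  define t where "t = min 1 (d / (2 * (norm (u - x) + 1)))"
  have n: "norm (u - x) + 1 > 0" by (simp add: add_nonneg_pos)
  have t: "0 < t" "t \<le> 1" using d n by (auto simp: t_def)
  have "t * norm (u - x) \<le> t * (norm (u - x) + 1)" using t by (intro mult_left_mono) auto
  also have "\<dots> \<le> d / (2 * (norm (u - x) + 1)) * (norm (u - x) + 1)"
    using n by (intro mult_right_mono) (auto simp: t_def)
  also have "\<dots> = d / 2" using n by (simp add: divide_eq_eq)
  finally have "t * norm (u - x) < d" using d by simp
  then have zb: "x + t *\<^sub>R (u - x) \<in> ball x d" using t by (simp add: dist_norm)
  have "\<psi> x + t * (v \<bullet> (u - x)) - e' * (t * norm (u - x)) \<le> \<psi> (x + t *\<^sub>R (u - x))"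
    using d(2)[OF zb] t by simp
  also have "x + t *\<^sub>R (u - x) = (1 - t) *\<^sub>R x + t *\<^sub>R u" by (simp add: algebra_simps)
  also have "\<psi> \<dots> \<le> (1 - t) * \<psi> x + t * \<psi> u"
    using t by (intro convex_onD[OF \<psi>]) auto
  finally have "t * (\<psi> x + v \<bullet> (u - x)) \<le> t * (\<psi> u + e' * norm (u - x))"
    by (simp add: algebra_simps)
  then have "\<psi> x + v \<bullet> (u - x) \<le> \<psi> u + e' * norm (u - x)" using t by simp
  then show "\<psi> x + v \<bullet> (u - x) \<le> \<psi> u + e" using e' by linarith
qed

lemma limiting_subdiff_convex:
  fixes \<psi> :: "'a::euclidean_space \<Rightarrow> real"
  assumes \<psi>: "convex_on UNIV \<psi>" and v: "v \<in> limiting_subdiff (\<lambda>u. ereal (\<psi> u)) x"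
  shows "\<psi> x + v \<bullet> (u - x) \<le> \<psi> u"
proof -
  obtain xk vk where lim: "xk \<longlonglongrightarrow> x" "(\<lambda>k. \<psi> (xk k)) \<longlonglongrightarrow> \<psi> x" "vk \<longlonglongrightarrow> v"
    and sub: "\<And>k. vk k \<in> frechet_subdiff (\<lambda>u. ereal (\<psi> u)) (xk k)"
    using v unfolding limiting_subdiff_def by auto
  have "(\<lambda>k. \<psi> (xk k) + vk k \<bullet> (u - xk k)) \<longlonglongrightarrow> \<psi> x + v \<bullet> (u - x)"
    by (intro tendsto_add tendsto_inner tendsto_diff tendsto_const lim)
  then show ?thesis
    by (rule LIMSEQ_le_const2) (use frechet_subdiff_convex[OF \<psi> sub] in blast)
qed

lemma frechet_subdiff_subset_limiting: "frechet_subdiff \<Phi> x \<subseteq> limiting_subdiff \<Phi> x"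
proof
  fix v assume v: "v \<in> frechet_subdiff \<Phi> x"
  then have "\<bar>\<Phi> x\<bar> \<noteq> \<infinity>" by (simp add: frechet_subdiff_def)
  with v show "v \<in> limiting_subdiff \<Phi> x"
    unfolding limiting_subdiff_def
    by (intro CollectI conjI exI[of _ "\<lambda>_. x"] exI[of _ "\<lambda>_. v"]) auto
qed

lemma ereal_convex_on_real:
  assumes "convex U" "convex_on UNIV g"
  shows "ereal_convex_on U (\<lambda>x. ereal (g x))"
  unfolding ereal_convex_on_def
proof
  have "convex (epigraph U g)"
    using assms convex_on_subset[of UNIV g U] by (simp add: convex_epigraph convex_on_def)
  moreover have "epigraph U g = {(x, r). x \<in> U \<and> ereal (g x) \<le> ereal r}"
    by (auto simp: epigraph_def)
  ultimately show "convex {(x, r). x \<in> U \<and> ereal (g x) \<le> ereal r}" by simp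
qed (fact assms)

text \<open>On a smaller radius \<open>subgrad\<close> replaces the loss \<open>- r / 2\<close> of
  \<open>prox\<close> by the gain \<open>\<sigma> / 2\<close>. The constant \<open>r\<close> remains
  as the parameter of the resolvents.\<close>

locale uniform_subgradients = prox_regular +
  fixes \<rho>' \<sigma> :: real
  assumes \<rho>': "0 < \<rho>'" "\<rho>' \<le> \<rho>" and \<sigma>: "0 \<le> \<sigma>"
    and subgrad: "\<And>x v u. regular_subgradient \<Gamma> f x v \<Longrightarrow> norm (x - xb) < \<rho>' \<Longrightarrow> norm v < \<rho>' \<Longrightarrow>
     u \<in> \<Gamma> \<Longrightarrow> norm (u - xb) < \<rho>' \<Longrightarrow> f x + v \<bullet> (u - x) + \<sigma> / 2 * (norm (u - x))\<^sup>2 \<le> f u"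
begin

abbreviation "\<Phi> \<equiv> extension \<Gamma> f"

lemma growth:
  assumes "norm (x - xb) < \<rho>'"
  shows "\<Phi> xb + ereal (\<sigma> / 2 * (norm (x - xb))\<^sup>2) \<le> \<Phi> x"
  using subgrad[OF crit, of x] assms \<rho>' xb by (auto simp: extension_def)

text \<open>The inequality in \<open>subgrad\<close> survives limits of graph points and, as
  \<open>0 \<le> \<sigma>\<close>, is itself a subgradient inequality at the limit. Feasibility of
  the limit comes from finiteness of \<open>\<Phi> x\<close>.\<close>

lemma limiting_imp_regular:
  assumes v: "v \<in> limiting_subdiff \<Phi> x" and x: "norm (x - xb) < \<rho>'" and nv: "norm v < \<rho>'"
  shows "regular_subgradient \<Gamma> f x v"
proof -
  obtain xk vk where lim: "xk \<longlonglongrightarrow> x" "(\<lambda>k. \<Phi> (xk k)) \<longlonglongrightarrow> \<Phi> x" "vk \<longlonglongrightarrow> v"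
    and sub: "\<And>k. regular_subgradient \<Gamma> f (xk k) (vk k)" and fin: "\<bar>\<Phi> x\<bar> \<noteq> \<infinity>"
    using v unfolding limiting_subdiff_def frechet_subdiff_extension mem_Collect_eq by metis
  have x\<Gamma>: "x \<in> \<Gamma>" using fin by (auto simp: extension_def split: if_splits)
  have "xk k \<in> \<Gamma>" for k using sub[of k] by (simp add: regular_subgradient_def)
  then have flim: "(\<lambda>k. f (xk k)) \<longlonglongrightarrow> f x" using lim(2) x\<Gamma> by (simp add: extension_def)
  have "(\<lambda>k. norm (xk k - xb)) \<longlonglongrightarrow> norm (x - xb)" by (intro tendsto_intros lim)
  then have ev1: "eventually (\<lambda>k. norm (xk k - xb) < \<rho>') sequentially" using x by (rule order_tendstoD)
  have ev2: "eventually (\<lambda>k. norm (vk k) < \<rho>') sequentially"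
    using tendsto_norm[OF lim(3)] nv by (rule order_tendstoD)
  have ineq: "f x + v \<bullet> (u - x) + \<sigma> / 2 * (norm (u - x))\<^sup>2 \<le> f u" if u: "u \<in> \<Gamma>" "norm (u - xb) < \<rho>'" for u
  proof (rule tendsto_upperbound)
    show "(\<lambda>k. f (xk k) + vk k \<bullet> (u - xk k) + \<sigma> / 2 * (norm (u - xk k))\<^sup>2)
        \<longlonglongrightarrow> f x + v \<bullet> (u - x) + \<sigma> / 2 * (norm (u - x))\<^sup>2"
      by (intro tendsto_add tendsto_inner tendsto_mult tendsto_power tendsto_norm tendsto_diff tendsto_const lim flim)
    show "eventually (\<lambda>k. f (xk k) + vk k \<bullet> (u - xk k) + \<sigma> / 2 * (norm (u - xk k))\<^sup>2 \<le> f u) sequentially"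
      using ev1 ev2 by eventually_elim (use subgrad[OF sub] u in blast)
  qed simp
  show ?thesis
  proof (rule regular_subgradient_of_quadratic_minorant[OF x\<Gamma>, where d="\<rho>' - norm (x - xb)" and c=0])
    fix u assume u: "u \<in> \<Gamma>" "u \<in> ball x (\<rho>' - norm (x - xb))"
    have "norm (u - xb) \<le> norm (u - x) + norm (x - xb)"
      using norm_triangle_ineq[of "u - x" "x - xb"] by simp
    then have "norm (u - xb) < \<rho>'" using u by (simp add: dist_norm norm_minus_commute)
    moreover have "0 \<le> \<sigma> / 2 * (norm (u - x))\<^sup>2" using \<sigma> by simp
    ultimately show "f x + v \<bullet> (u - x) - 0 * (norm (u - x))\<^sup>2 \<le> f u" using ineq[of u] u by simp
  qed (use x in simp)
qed

lemma regular_imp_limiting: "regular_subgradient \<Gamma> f x v \<Longrightarrow> v \<in> limiting_subdiff \<Phi> x"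
  using frechet_subdiff_subset_limiting frechet_subdiff_extension by blast

section \<open>The convex minorant\<close>

definition G where "G = {(x, v). regular_subgradient \<Gamma> f x v \<and> norm (x - xb) < \<rho>' \<and> norm v < \<rho>'}"

definition a where "a p u = f (fst p) + snd p \<bullet> (u - fst p) + \<sigma> / 2 * (norm (u - fst p))\<^sup>2"

text \<open>All quadratics \<open>a p\<close> share the leading term
  \<open>\<sigma> / 2 |u|^2\<close>, so \<open>\<psi>\<close> minus this term is a supremum of
  affine functions. Since \<open>G\<close> and the values of \<open>f\<close> on it are bounded, the
  supremum is finite on the whole space.\<close>

definition \<psi> where "\<psi> u = (SUP p\<in>G. a p u)"

lemma G_nonempty: "(xb, 0) \<in> G"
  using crit \<rho>' by (simp add: G_def)

lemma bdd_above_a: "bdd_above ((\<lambda>p. a p u) ` G)"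
proof -
  have "compact (f ` (\<Gamma> \<inter> cball xb \<rho>))" by (rule compact_continuous_image[OF cont comp])
  then obtain B where B: "\<And>x. x \<in> \<Gamma> \<inter> cball xb \<rho> \<Longrightarrow> f x \<le> B"
    using compact_imp_bounded bounded_imp_bdd_above unfolding bdd_above_def by (metis imageI)
  show ?thesis
  proof (rule bdd_aboveI2[where M="B + \<rho>' * (norm (u - xb) + \<rho>') + \<sigma> / 2 * (norm (u - xb) + \<rho>')\<^sup>2"])
    fix p assume p: "p \<in> G"
    obtain x v where xv: "p = (x, v)" by (cases p)
    have "x \<in> \<Gamma>" "norm (x - xb) < \<rho>'" "norm v < \<rho>'"
      using p xv by (auto simp: G_def regular_subgradient_def)
    then have 1: "f x \<le> B" using \<rho>' by (intro B) (auto simp: dist_norm norm_minus_commute)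
    have 2: "norm (u - x) \<le> norm (u - xb) + \<rho>'"
      using norm_triangle_ineq4[of "u - xb" "x - xb"] \<open>norm (x - xb) < \<rho>'\<close> by simp
    have "v \<bullet> (u - x) \<le> norm v * norm (u - x)" by (rule norm_cauchy_schwarz)
    also have "\<dots> \<le> \<rho>' * (norm (u - xb) + \<rho>')"
      using 2 \<open>norm v < \<rho>'\<close> \<rho>' by (intro mult_mono) auto
    finally have 3: "v \<bullet> (u - x) \<le> \<rho>' * (norm (u - xb) + \<rho>')" .
    have 4: "\<sigma> / 2 * (norm (u - x))\<^sup>2 \<le> \<sigma> / 2 * (norm (u - xb) + \<rho>')\<^sup>2"
      using 2 \<sigma> by (intro mult_left_mono power_mono) auto
    show "a p u \<le> B + \<rho>' * (norm (u - xb) + \<rho>') + \<sigma> / 2 * (norm (u - xb) + \<rho>')\<^sup>2"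
      using 1 3 4 by (simp add: a_def xv)
  qed
qed

lemma \<psi>_ge: "p \<in> G \<Longrightarrow> a p u \<le> \<psi> u"
  unfolding \<psi>_def by (rule cSUP_upper[OF _ bdd_above_a])

lemma \<psi>_le: "(\<And>p. p \<in> G \<Longrightarrow> a p u \<le> M) \<Longrightarrow> \<psi> u \<le> M"
  unfolding \<psi>_def using G_nonempty by (intro cSUP_least) auto

lemma \<psi>_le_f: "u \<in> \<Gamma> \<Longrightarrow> norm (u - xb) < \<rho>' \<Longrightarrow> \<psi> u \<le> f u"
  by (rule \<psi>_le) (use subgrad in \<open>auto simp: G_def a_def\<close>)

lemma \<psi>_eq_f: "(x, v) \<in> G \<Longrightarrow> \<psi> x = f x"
  using \<psi>_le_f[of x] \<psi>_ge[of "(x, v)" x] by (auto simp: G_def a_def regular_subgradient_def)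

lemma \<psi>_subgradient:
  assumes "(x, v) \<in> G"
  shows "\<psi> x + v \<bullet> (u - x) \<le> \<psi> u"
proof -
  have "0 \<le> \<sigma> / 2 * (norm (u - x))\<^sup>2" using \<sigma> by simp
  then show ?thesis using \<psi>_ge[OF assms, of u] \<psi>_eq_f[OF assms] by (simp add: a_def)
qed

lemma \<psi>_strongly_convex:
  assumes t: "0 \<le> t" "t \<le> 1"
  shows "\<psi> ((1 - t) *\<^sub>R x + t *\<^sub>R y) \<le> (1 - t) * \<psi> x + t * \<psi> y - \<sigma> / 2 * (t * (1 - t) * (norm (x - y))\<^sup>2)"
proof (rule \<psi>_le)
  fix p assume p: "p \<in> G"
  let ?x = "fst p" and ?v = "snd p"
  have e: "(1 - t) *\<^sub>R x + t *\<^sub>R y - ?x = (1 - t) *\<^sub>R (x - ?x) + t *\<^sub>R (y - ?x)" by (simp add: algebra_simps)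
  have "a p ((1 - t) *\<^sub>R x + t *\<^sub>R y) = (1 - t) * a p x + t * a p y - \<sigma> / 2 * (t * (1 - t) * (norm (x - y))\<^sup>2)"
    unfolding a_def e convex_combination_norm_sq
    by (simp add: inner_add_right algebra_simps add_divide_distrib diff_divide_distrib)
  also have "\<dots> \<le> (1 - t) * \<psi> x + t * \<psi> y - \<sigma> / 2 * (t * (1 - t) * (norm (x - y))\<^sup>2)"
    using t \<psi>_ge[OF p] by (intro diff_right_mono add_mono mult_left_mono) auto
  finally show "a p ((1 - t) *\<^sub>R x + t *\<^sub>R y) \<le> (1 - t) * \<psi> x + t * \<psi> y - \<sigma> / 2 * (t * (1 - t) * (norm (x - y))\<^sup>2)" .
qed

lemma convex_\<psi>: "convex_on UNIV \<psi>"
proof (rule convex_onI)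
  fix t :: real and x y :: 'a assume t: "0 < t" "t < 1"
  have "0 \<le> \<sigma> / 2 * (t * (1 - t) * (norm (x - y))\<^sup>2)" using \<sigma> t by simp
  then show "\<psi> ((1 - t) *\<^sub>R x + t *\<^sub>R y) \<le> (1 - t) * \<psi> x + t * \<psi> y"
    using \<psi>_strongly_convex[of t x y] t by simp
qed simp

lemma convex_\<psi>_minus: "convex_on UNIV (\<lambda>x. \<psi> x - \<sigma> / 2 * (norm x)\<^sup>2)"
proof (rule convex_onI)
  fix t :: real and x y :: 'a assume t: "0 < t" "t < 1"
  define z where "z = (1 - t) *\<^sub>R x + t *\<^sub>R y"
  have "(norm z)\<^sup>2 = (1 - t) * (norm x)\<^sup>2 + t * (norm y)\<^sup>2 - t * (1 - t) * (norm (x - y))\<^sup>2"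
    unfolding z_def by (rule convex_combination_norm_sq)
  moreover have "\<psi> z \<le> (1 - t) * \<psi> x + t * \<psi> y - \<sigma> / 2 * (t * (1 - t) * (norm (x - y))\<^sup>2)"
    unfolding z_def using t by (intro \<psi>_strongly_convex) auto
  ultimately have "\<psi> z - \<sigma> / 2 * (norm z)\<^sup>2 \<le> (1 - t) * \<psi> x + t * \<psi> y - \<sigma> / 2 * (t * (1 - t) * (norm (x - y))\<^sup>2)
      - \<sigma> / 2 * ((1 - t) * (norm x)\<^sup>2 + t * (norm y)\<^sup>2 - t * (1 - t) * (norm (x - y))\<^sup>2)"
    by simp
  then have "\<psi> z - \<sigma> / 2 * (norm z)\<^sup>2
      \<le> (1 - t) * (\<psi> x - \<sigma> / 2 * (norm x)\<^sup>2) + t * (\<psi> y - \<sigma> / 2 * (norm y)\<^sup>2)"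
    by (simp add: algebra_simps add_divide_distrib diff_divide_distrib)
  then show "\<psi> ((1 - t) *\<^sub>R x + t *\<^sub>R y) - \<sigma> / 2 * (norm ((1 - t) *\<^sub>R x + t *\<^sub>R y))\<^sup>2
      \<le> (1 - t) * (\<psi> x - \<sigma> / 2 * (norm x)\<^sup>2) + t * (\<psi> y - \<sigma> / 2 * (norm y)\<^sup>2)"
    by (simp only: z_def)
qed simp

lemma continuous_\<psi>: "isCont \<psi> x"
  using convex_on_continuous[OF open_UNIV convex_\<psi>] by (simp add: continuous_on_eq_continuous_at)

text \<open>Minty's argument, localized. \<open>prox_exists\<close> provides a point
  \<open>(x', v')\<close> of \<open>G\<close> with the same \<open>z\<close>, so
  \<open>v - v'\<close> equals \<open>- 2 r (x - x')\<close>; monotonicity of the subdifferential of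
  \<open>\<psi>\<close>, which contains \<open>G\<close>, then forces \<open>x = x'\<close>.\<close>

lemma subgradient_of_\<psi>_in_G:
  assumes v: "v \<in> limiting_subdiff (\<lambda>u. ereal (\<psi> u)) x"
    and z: "4 * norm (x + v /\<^sub>R (2 * r) - xb) < \<rho>'" "10 * r * norm (x + v /\<^sub>R (2 * r) - xb) < \<rho>'"
  shows "(x, v) \<in> G"
proof -
  define z where "z = x + v /\<^sub>R (2 * r)"
  have z': "4 * norm (z - xb) < \<rho>'" "10 * r * norm (z - xb) < \<rho>'" using z by (simp_all add: z_def)
  then obtain x' where x': "regular_subgradient \<Gamma> f x' ((2 * r) *\<^sub>R (z - x'))"
      "norm (x' - xb) \<le> 4 * norm (z - xb)" "norm ((2 * r) *\<^sub>R (z - x')) \<le> 10 * r * norm (z - xb)"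
    using prox_exists[of z] \<rho>'(2) by (meson less_le_trans)
  define v' where "v' = (2 * r) *\<^sub>R (z - x')"
  have G': "(x', v') \<in> G" using x' z' by (simp add: G_def v'_def)
  have "v = (2 * r) *\<^sub>R (z - x)" using r by (simp add: z_def)
  then have "v - v' = - ((2 * r) *\<^sub>R (x - x'))" by (simp add: v'_def algebra_simps)
  moreover have "0 \<le> (v - v') \<bullet> (x - x')"
    using limiting_subdiff_convex[OF convex_\<psi> v, of x'] \<psi>_subgradient[OF G', of x]
    by (simp add: inner_diff algebra_simps)
  ultimately have "2 * r * ((x - x') \<bullet> (x - x')) \<le> 0" by simp
  then have "(x - x') \<bullet> (x - x') \<le> 0" using r by (simp add: mult_le_0_iff)
  then have "x = x'" by (metis eq_iff_diff_eq_0 inner_ge_zero inner_eq_zero_iff order_antisym)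
  then show ?thesis using G' \<open>v = _\<close> by (simp add: v'_def)
qed

theorem variational_strong_convexity:
  "var_convex_gen (\<lambda>U \<psi>. ereal_strongly_convex_on U \<sigma> \<psi>) \<Phi> xb 0"
proof -
  \<comment> \<open>For \<open>x\<close> and \<open>v\<close> within \<open>\<alpha>\<close> of
    \<open>xb\<close> and \<open>0\<close>, the point \<open>x + v / (2 r)\<close> is closer to
    \<open>xb\<close> than \<open>(1 + 1 / (2 r)) \<alpha>\<close>; the factor
    \<open>4 + 10 * r\<close> serves both smallness conditions of the resolvent at once.\<close>
  define C where "C = (1 + 1 / (2 * r)) * (4 + 10 * r)"
  have C: "C > 0" using r by (simp add: C_def add_pos_pos)
  define \<alpha> where "\<alpha> = min \<rho>' (\<rho>' / C)"
  have \<alpha>: "0 < \<alpha>" "\<alpha> \<le> \<rho>'" "C * \<alpha> \<le> \<rho>'"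
  proof -
    show "0 < \<alpha>" "\<alpha> \<le> \<rho>'" using \<rho>' C by (auto simp: \<alpha>_def)
    have "C * \<alpha> \<le> C * (\<rho>' / C)" using C by (intro mult_left_mono) (auto simp: \<alpha>_def)
    then show "C * \<alpha> \<le> \<rho>'" using C by simp
  qed
  have small: "4 * norm (x + v /\<^sub>R (2 * r) - xb) < \<rho>'" "10 * r * norm (x + v /\<^sub>R (2 * r) - xb) < \<rho>'"
    if "norm (x - xb) < \<alpha>" "norm v < \<alpha>" for x v
  proof -
    define n where "n = norm (x + v /\<^sub>R (2 * r) - xb)"
    have "n \<le> norm (x - xb) + norm (v /\<^sub>R (2 * r))"
      unfolding n_def using norm_triangle_ineq[of "x - xb" "v /\<^sub>R (2 * r)"] by (simp add: algebra_simps)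
    also have "norm (v /\<^sub>R (2 * r)) = norm v / (2 * r)"
      using r by (simp add: inverse_eq_divide)
    also have "norm (x - xb) + norm v / (2 * r) < \<alpha> + \<alpha> / (2 * r)"
      using that r by (intro add_strict_mono divide_strict_right_mono) auto
    also have "\<dots> = (1 + 1 / (2 * r)) * \<alpha>" by (simp add: distrib_right)
    finally have "(4 + 10 * r) * n < (4 + 10 * r) * ((1 + 1 / (2 * r)) * \<alpha>)"
      using r by (intro mult_strict_left_mono) auto
    also have "\<dots> = C * \<alpha>" by (simp add: C_def mult_ac)
    finally have "4 * n + 10 * r * n < \<rho>'" using \<alpha>(3) by (simp add: distrib_right)
    moreover have "0 \<le> 4 * n" "0 \<le> 10 * r * n" using r by (auto simp: n_def)
    ultimately show "4 * norm (x + v /\<^sub>R (2 * r) - xb) < \<rho>'" "10 * r * norm (x + v /\<^sub>R (2 * r) - xb) < \<rho>'"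
      unfolding n_def[symmetric] by linarith+
  qed
  \<comment> \<open>The level \<open>\<alpha> * \<alpha>\<close> is chosen as \<epsilon> because the
    subgradient inequality at \<open>x\<close>, tested at \<open>xb\<close>, gives
    \<open>f x \<le> f xb + v . (x - xb)\<close>. The level condition then holds automatically for
    subgradients of \<open>\<psi>\<close> in the neighborhood.\<close>
  have in_G: "(x, v) \<in> G \<and> \<Phi> x < \<Phi> xb + ereal (\<alpha> * \<alpha>)"
    if xv: "norm (x - xb) < \<alpha>" "norm v < \<alpha>" and v: "v \<in> limiting_subdiff (\<lambda>u. ereal (\<psi> u)) x" for x v
  proof
    show G: "(x, v) \<in> G" by (rule subgradient_of_\<psi>_in_G[OF v small[OF xv]])
    then have "f x + v \<bullet> (xb - x) + \<sigma> / 2 * (norm (xb - x))\<^sup>2 \<le> f xb"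
      using xb \<rho>' by (intro subgrad) (auto simp: G_def)
    moreover have "0 \<le> \<sigma> / 2 * (norm (xb - x))\<^sup>2" using \<sigma> by simp
    ultimately have "f x \<le> f xb + v \<bullet> (x - xb)" by (simp add: inner_diff_right)
    also have "v \<bullet> (x - xb) \<le> norm v * norm (x - xb)" by (rule norm_cauchy_schwarz)
    also have "\<dots> < \<alpha> * \<alpha>" using xv by (intro mult_strict_mono') auto
    finally show "\<Phi> x < \<Phi> xb + ereal (\<alpha> * \<alpha>)"
      using G xb by (auto simp: extension_def G_def regular_subgradient_def)
  qed
  have in_\<psi>: "v \<in> limiting_subdiff (\<lambda>u. ereal (\<psi> u)) x" if "(x, v) \<in> G" for x v
  proof -
    have "v \<in> frechet_subdiff (\<lambda>u. ereal (\<psi> u)) x"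
      unfolding frechet_subdiff_def
    proof (intro CollectI conjI allI impI)
      fix e :: real assume "e > 0"
      then have "0 \<le> e * norm (u - x)" for u by simp
      then have "\<psi> x + (v \<bullet> (u - x) - e * norm (u - x)) \<le> \<psi> u" for u
        using \<psi>_subgradient[OF that, of u] by (smt (verit))
      then have "ereal (\<psi> x) + ereal (v \<bullet> (u - x) - e * norm (u - x)) \<le> ereal (\<psi> u)" for u by simp
      then show "\<exists>d>0. \<forall>u\<in>ball x d. ereal (\<psi> x) + ereal (v \<bullet> (u - x) - e * norm (u - x)) \<le> ereal (\<psi> u)"
        by (intro exI[of _ 1]) simp
    qed simp
    then show ?thesis using frechet_subdiff_subset_limiting by blast
  qed
  have nb: "x \<in> ball xb \<alpha> \<longleftrightarrow> norm (x - xb) < \<alpha>" "v \<in> ball 0 \<alpha> \<longleftrightarrow> norm v < \<alpha>" for x v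
    by (auto simp: dist_norm norm_minus_commute)
  show ?thesis
    unfolding var_convex_gen_def
  proof (rule conjI[OF regular_imp_limiting[OF crit]], rule exI[of _ "ball xb \<alpha>"], rule exI[of _ "ball 0 \<alpha>"],
      rule exI[of _ "\<alpha> * \<alpha>"], rule exI[of _ "\<lambda>u. ereal (\<psi> u)"], intro conjI ballI allI impI)
    show "lsc_on (ball xb \<alpha>) (\<lambda>u. ereal (\<psi> u))"
      unfolding lsc_on_def
    proof (intro ballI allI impI)
      fix x c assume "c < ereal (\<psi> x)"
      moreover have "((\<lambda>u. ereal (\<psi> u)) \<longlongrightarrow> ereal (\<psi> x)) (at x)"
        using continuous_\<psi> by (simp add: isCont_def)
      ultimately show "eventually (\<lambda>u. c < ereal (\<psi> u)) (at x)" by (simp add: order_tendsto_iff)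
    qed
    show "ereal_strongly_convex_on (ball xb \<alpha>) \<sigma> (\<lambda>u. ereal (\<psi> u))"
      using ereal_convex_on_real[OF convex_ball convex_\<psi>_minus]
      by (simp add: ereal_strongly_convex_on_def)
    show "ereal (\<psi> x) \<le> \<Phi> x" if "x \<in> ball xb \<alpha>" for x
    proof (cases "x \<in> \<Gamma>")
      case True
      have "norm (x - xb) < \<rho>'" using that \<alpha>(2) unfolding nb by simp
      with True show ?thesis using \<psi>_le_f[of x] by (simp add: extension_def)
    qed (simp add: extension_def)
    show "\<Phi> x = ereal (\<psi> x)"
      if "x \<in> ball xb \<alpha> \<and> v \<in> ball 0 \<alpha> \<and> v \<in> limiting_subdiff (\<lambda>u. ereal (\<psi> u)) x" for x v
    proof -
      have "(x, v) \<in> G" using in_G that unfolding nb by blast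
      then show ?thesis using \<psi>_eq_f[of x v] by (auto simp: extension_def G_def regular_subgradient_def)
    qed
    show "(x \<in> ball xb \<alpha> \<and> \<Phi> x < \<Phi> xb + ereal (\<alpha> * \<alpha>) \<and> v \<in> ball 0 \<alpha> \<and> v \<in> limiting_subdiff \<Phi> x) \<longleftrightarrow>
      (x \<in> ball xb \<alpha> \<and> v \<in> ball 0 \<alpha> \<and> v \<in> limiting_subdiff (\<lambda>u. ereal (\<psi> u)) x)" for x v
    proof
      assume *: "x \<in> ball xb \<alpha> \<and> \<Phi> x < \<Phi> xb + ereal (\<alpha> * \<alpha>) \<and> v \<in> ball 0 \<alpha> \<and> v \<in> limiting_subdiff \<Phi> x"
      then have xv: "norm (x - xb) < \<rho>'" "norm v < \<rho>'" using \<alpha>(2) unfolding nb by auto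
      then have "(x, v) \<in> G" using limiting_imp_regular[OF _ xv] * by (simp add: G_def)
      then show "x \<in> ball xb \<alpha> \<and> v \<in> ball 0 \<alpha> \<and> v \<in> limiting_subdiff (\<lambda>u. ereal (\<psi> u)) x"
        using * in_\<psi> by blast
    next
      assume *: "x \<in> ball xb \<alpha> \<and> v \<in> ball 0 \<alpha> \<and> v \<in> limiting_subdiff (\<lambda>u. ereal (\<psi> u)) x"
      then have "(x, v) \<in> G \<and> \<Phi> x < \<Phi> xb + ereal (\<alpha> * \<alpha>)" unfolding nb by (intro in_G) auto
      then show "x \<in> ball xb \<alpha> \<and> \<Phi> x < \<Phi> xb + ereal (\<alpha> * \<alpha>) \<and> v \<in> ball 0 \<alpha> \<and> v \<in> limiting_subdiff \<Phi> x"
        using * regular_imp_limiting by (auto simp: G_def)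
    qed
  qed (use \<alpha> in auto)
qed

section \<open>Local minimality and tilt stability\<close>

lemma local_min: "local_minimizer \<Phi> xb"
  unfolding local_minimizer_def
proof (intro exI[of _ \<rho>'] conjI ballI)
  fix x assume "x \<in> ball xb \<rho>'"
  then have x: "norm (x - xb) < \<rho>'" by (simp add: dist_norm norm_minus_commute)
  have "ereal 0 \<le> ereal (\<sigma> / 2 * (norm (x - xb))\<^sup>2)" using \<sigma> by simp
  then have "\<Phi> xb + ereal 0 \<le> \<Phi> xb + ereal (\<sigma> / 2 * (norm (x - xb))\<^sup>2)" by (rule add_left_mono)
  then show "\<Phi> xb \<le> \<Phi> x" using growth[OF x] by (metis order_trans add.right_neutral zero_ereal_def)
qed (use \<rho>' in simp)

lemma strong_local_min:
  assumes "\<sigma> > 0"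
  shows "strong_local_minimizer \<Phi> xb"
  unfolding strong_local_minimizer_def
  using growth assms \<rho>' by (intro exI[of _ "\<sigma> / 2"] conjI exI[of _ \<rho>']) (auto simp: dist_norm norm_minus_commute)

text \<open>Because \<open>\<gamma> < \<rho>'\<close>, the subgradient inequality compares
  \<open>x\<close> with every feasible point of the closed ball; its quadratic term makes the
  minimizer unique.\<close>

lemma Mgamma_eq:
  assumes \<sigma>0: "\<sigma> > 0" and \<gamma>: "\<gamma> < \<rho>'" and sub: "regular_subgradient \<Gamma> f x v"
    and x: "norm (x - xb) \<le> \<gamma>" and v: "norm v < \<rho>'"
  shows "Mgamma \<Phi> xb \<gamma> v = {x}"
proof -
  have x\<Gamma>: "x \<in> \<Gamma>" using sub by (simp add: regular_subgradient_def)
  have key: "f x - v \<bullet> x + \<sigma> / 2 * (norm (z - x))\<^sup>2 \<le> f z - v \<bullet> z" if "z \<in> \<Gamma>" "norm (z - xb) \<le> \<gamma>" for z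
    using subgrad[OF sub _ v, of z] x \<gamma> that by (simp add: inner_diff_right)
  show ?thesis
  proof (rule set_eqI, unfold singleton_iff, rule iffI)
    fix z assume "z = x"
    have "\<Phi> x - ereal (v \<bullet> x) \<le> \<Phi> u - ereal (v \<bullet> u)" if u: "norm (u - xb) \<le> \<gamma>" for u
    proof (cases "u \<in> \<Gamma>")
      case True
      have "0 \<le> \<sigma> / 2 * (norm (u - x))\<^sup>2" using \<sigma> by simp
      then have "f x - v \<bullet> x \<le> f u - v \<bullet> u" using key[OF True u] by linarith
      then show ?thesis using True x\<Gamma> by (simp add: extension_def)
    qed (simp add: extension_def)
    then show "z \<in> Mgamma \<Phi> xb \<gamma> v" using x \<open>z = x\<close> by (simp add: Mgamma_def)
  next
    fix z assume z: "z \<in> Mgamma \<Phi> xb \<gamma> v"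
    then have zn: "norm (z - xb) \<le> \<gamma>" and le: "\<Phi> z - ereal (v \<bullet> z) \<le> \<Phi> x - ereal (v \<bullet> x)"
      using x by (auto simp: Mgamma_def)
    have z\<Gamma>: "z \<in> \<Gamma>" using le x\<Gamma> by (auto simp: extension_def split: if_splits)
    have "f z - v \<bullet> z \<le> f x - v \<bullet> x" using le z\<Gamma> x\<Gamma> by (simp add: extension_def)
    then have "\<sigma> / 2 * (norm (z - x))\<^sup>2 \<le> 0" using key[OF z\<Gamma> zn] by linarith
    then show "z = x" using \<sigma>0 by (simp add: mult_le_0_iff)
  qed
qed

text \<open>Adding the strong subgradient inequalities at \<open>M v\<close> and \<open>M w\<close>
  gives \<open>\<sigma> |D|^2 \<le> (v - w) . D\<close> for \<open>D = M v - M w\<close>, hence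
  exactly the constant \<open>1 / \<sigma>\<close>.\<close>

theorem tilt_stability:
  assumes \<sigma>0: "\<sigma> > 0"
  shows "tilt_stable_min \<Phi> xb (1 / \<sigma>)"
proof -
  define \<gamma> where "\<gamma> = \<rho>' / 2"
  have \<gamma>: "0 < \<gamma>" "\<gamma> < \<rho>'" "\<gamma> \<le> \<rho>" using \<rho>' by (auto simp: \<gamma>_def)
  \<comment> \<open>Quadratic growth at \<open>xb\<close> places a minimizer of the tilted function
    within \<open>2 * norm v / \<sigma>\<close> of \<open>xb\<close>. The bound
    \<open>\<sigma> * \<gamma> / 2\<close> keeps it off the boundary of the ball, so that
    \<open>v\<close> is a subgradient there.\<close>
  define d where "d = min \<rho>' (\<sigma> * \<gamma> / 2)"
  have d: "d > 0" "d \<le> \<rho>'" "2 * d \<le> \<sigma> * \<gamma>" using \<rho>' \<sigma>0 \<gamma> by (auto simp: d_def min_def)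
  have ex: "\<exists>x. regular_subgradient \<Gamma> f x v \<and> norm (x - xb) \<le> \<gamma>" if v: "norm v < d" for v
  proof -
    have sub: "\<Gamma> \<inter> cball xb \<gamma> \<subseteq> \<Gamma> \<inter> cball xb \<rho>" using \<gamma> by auto
    have "\<Gamma> \<inter> cball xb \<gamma> = (\<Gamma> \<inter> cball xb \<rho>) \<inter> cball xb \<gamma>" using \<gamma> by auto
    then have "compact (\<Gamma> \<inter> cball xb \<gamma>)" using compact_Int[OF comp compact_cball] by metis
    moreover have "continuous_on (\<Gamma> \<inter> cball xb \<gamma>) (\<lambda>u. f u - v \<bullet> u)"
      by (intro continuous_intros continuous_on_subset[OF cont sub])
    moreover have "xb \<in> \<Gamma> \<inter> cball xb \<gamma>" using xb \<gamma> by simp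
    ultimately obtain x where x: "x \<in> \<Gamma> \<inter> cball xb \<gamma>"
      and min: "\<And>u. u \<in> \<Gamma> \<inter> cball xb \<gamma> \<Longrightarrow> f x - v \<bullet> x \<le> f u - v \<bullet> u"
      using continuous_attains_inf[of "\<Gamma> \<inter> cball xb \<gamma>" "\<lambda>u. f u - v \<bullet> u"] by blast
    have xn: "norm (x - xb) \<le> \<gamma>" using x by (simp add: dist_norm norm_minus_commute)
    have "f xb + \<sigma> / 2 * (norm (x - xb))\<^sup>2 \<le> f x"
      using subgrad[OF crit, of x] x xn \<gamma> \<rho>' by simp
    moreover have "f x - v \<bullet> x \<le> f xb - v \<bullet> xb" using xb \<gamma> by (intro min) simp
    moreover have "v \<bullet> (x - xb) \<le> norm v * norm (x - xb)" by (rule norm_cauchy_schwarz)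
    ultimately have "\<sigma> / 2 * norm (x - xb) * norm (x - xb) \<le> norm v * norm (x - xb)"
      by (simp add: inner_diff_right power2_eq_square)
    then have "norm (x - xb) = 0 \<or> \<sigma> / 2 * norm (x - xb) \<le> norm v"
      by (metis mult_right_le_imp_le norm_ge_zero order_le_less)
    then have "\<sigma> * norm (x - xb) \<le> 2 * norm v" by auto
    also have "\<dots> < \<sigma> * \<gamma>" using v d(3) by simp
    finally have xs: "norm (x - xb) < \<gamma>" using \<sigma>0 by simp
    have "regular_subgradient \<Gamma> f x v"
    proof (rule regular_subgradient_of_quadratic_minorant[where d="\<gamma> - norm (x - xb)" and c=0])
      fix u assume u: "u \<in> \<Gamma>" "u \<in> ball x (\<gamma> - norm (x - xb))"
      have "norm (u - xb) \<le> norm (u - x) + norm (x - xb)"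
        using norm_triangle_ineq[of "u - x" "x - xb"] by simp
      then have "u \<in> \<Gamma> \<inter> cball xb \<gamma>" using u by (simp add: dist_norm norm_minus_commute)
      from min[OF this] show "f x + v \<bullet> (u - x) - 0 * (norm (u - x))\<^sup>2 \<le> f u"
        by (simp add: inner_diff_right)
    qed (use x xs in auto)
    then show ?thesis using xn by blast
  qed
  define M where "M v = (SOME x. regular_subgradient \<Gamma> f x v \<and> norm (x - xb) \<le> \<gamma>)" for v
  have M: "regular_subgradient \<Gamma> f (M v) v" "norm (M v - xb) \<le> \<gamma>" if "norm v < d" for v
    using someI_ex[OF ex[OF that]] by (auto simp: M_def)
  have lip: "dist (M v) (M w) \<le> 1 / \<sigma> * dist v w" if vw: "norm v < d" "norm w < d" for v w
  proof -
    have \<Gamma>: "M v \<in> \<Gamma>" "M w \<in> \<Gamma>" using M(1) vw by (auto simp: regular_subgradient_def)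
    have n: "norm (M v - xb) < \<rho>'" "norm (M w - xb) < \<rho>'" using M(2) vw \<gamma>(2) by (auto intro: le_less_trans)
    define D where "D = M v - M w"
    have "f (M v) + v \<bullet> (M w - M v) + \<sigma> / 2 * (norm (M w - M v))\<^sup>2 \<le> f (M w)"
      using subgrad[OF M(1)[OF vw(1)] n(1) _ \<Gamma>(2) n(2)] vw d by simp
    moreover have "f (M w) + w \<bullet> (M v - M w) + \<sigma> / 2 * (norm (M v - M w))\<^sup>2 \<le> f (M v)"
      using subgrad[OF M(1)[OF vw(2)] n(2) _ \<Gamma>(1) n(1)] vw d by simp
    ultimately have "\<sigma> * (norm D)\<^sup>2 \<le> (v - w) \<bullet> D"
      by (simp add: D_def inner_diff norm_minus_commute)
    also have "\<dots> \<le> norm (v - w) * norm D" by (rule norm_cauchy_schwarz)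
    finally have "\<sigma> * norm D * norm D \<le> norm (v - w) * norm D" by (simp add: power2_eq_square)
    then have "norm D = 0 \<or> \<sigma> * norm D \<le> norm (v - w)"
      by (metis mult_right_le_imp_le norm_ge_zero order_le_less)
    then have "\<sigma> * norm D \<le> norm (v - w)" by auto
    then show ?thesis using \<sigma>0 by (simp add: D_def dist_norm pos_le_divide_eq mult.commute)
  qed
  have "Mgamma \<Phi> xb \<gamma> 0 = {xb}"
    using \<gamma> \<rho>' by (intro Mgamma_eq[OF \<sigma>0 _ crit]) auto
  moreover have "Mgamma \<Phi> xb \<gamma> v = {M v}" if "v \<in> ball 0 d" for v
    using M[of v] that d(2) by (intro Mgamma_eq[OF \<sigma>0 \<gamma>(2)]) auto
  moreover have "dist (M v) (M w) \<le> 1 / \<sigma> * dist v w" if "v \<in> ball 0 d" "w \<in> ball 0 d" for v w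
    using lip that by simp
  ultimately show ?thesis
    unfolding tilt_stable_min_def using \<gamma>(1) d(1) by blast
qed

end

section \<open>From the second-order condition to the theorem\<close>

lemma (in nlp) second_order_imp_uniform_subgradients:
  assumes xb: "xb \<in> \<Gamma>" and crit: "regular_subgradient \<Gamma> f xb 0" and \<sigma>: "0 \<le> \<sigma>"
    and U: "open U" "xb \<in> U" and V: "open V" "0 \<in> V"
    and second_order: "\<And>x y w. \<lbrakk>x \<in> U; y \<in> mult_cone s; grad (\<lambda>z. Lag f \<phi> m z y) x \<in> V;
      ypair \<phi> m y x = 0; w \<in> Scone \<phi> s m x y\<rbrakk> \<Longrightarrow>
      \<sigma> * (norm w)\<^sup>2 \<le> hess f x w \<bullet> w + w \<bullet> hess (ypair \<phi> m y) x w"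
  shows "\<exists>\<rho> \<rho>'. uniform_subgradients \<Gamma> f xb \<rho> R \<rho>' \<sigma>"
proof -
  obtain e1 where e1: "e1 > 0" "ball xb e1 \<subseteq> U" using U open_contains_ball by blast
  obtain e2 where e2: "e2 > 0" "ball 0 e2 \<subseteq> V" using V open_contains_ball by blast
  \<comment> \<open>\<open>e1\<close> and \<open>e2\<close> fit the given neighborhoods,
    \<open>1\<close> meets the norm bound on \<open>v\<close> in \<open>bounded_multipliers\<close>,
    and \<open>\<delta> / 2\<close> keeps closed balls inside the region of the Taylor
    bounds.\<close>
  define \<rho> where "\<rho> = min (min e1 e2) (min 1 (\<delta> / 2))"
  have \<rho>: "0 < \<rho>" "\<rho> < \<delta>" "\<rho> \<le> 1" "\<rho> \<le> e1" "\<rho> \<le> e2" using e1 e2 \<delta> by (auto simp: \<rho>_def)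
  have UV: "ball xb \<rho> \<subseteq> U" "ball 0 \<rho> \<subseteq> V" using e1(2) e2(2) \<rho>(4,5) by (auto intro: subset_ball[THEN subsetD])
  interpret pr: prox_regular \<Gamma> f xb \<rho> R by (rule prox_regular[OF xb crit \<rho>(1-3)])
  interpret pri: prox_regular_infinitesimal \<Gamma> f xb \<rho> R \<sigma>
  proof
    show "0 \<le> \<sigma>" by (fact \<sigma>)
    show "\<sigma> * (norm w)\<^sup>2 \<le> q \<bullet> w"
      if "regular_subgradient \<Gamma> f x v" "norm (x - xb) < \<rho>" "norm v < \<rho>"
        "\<And>k. regular_subgradient \<Gamma> f (X k) (V k)" "\<And>k::nat. norm (X k - xb) < \<rho>" "\<And>k. norm (V k) < \<rho>"
        "\<And>k. 0 < t k" "t \<longlonglongrightarrow> 0" "(\<lambda>k. (X k - x) /\<^sub>R t k) \<longlonglongrightarrow> w" "(\<lambda>k. (V k - v) /\<^sub>R t k) \<longlonglongrightarrow> q"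
      for x v X V t w q
      by (rule infinitesimal_monotonicity[OF _ \<rho>(2,3) that]) (use UV in \<open>blast intro: second_order\<close>)
  qed
  obtain \<rho>' where \<rho>': "0 < \<rho>'" "\<rho>' \<le> \<rho>"
    "\<And>x v u. regular_subgradient \<Gamma> f x v \<Longrightarrow> norm (x - xb) < \<rho>' \<Longrightarrow> norm v < \<rho>' \<Longrightarrow>
       u \<in> \<Gamma> \<Longrightarrow> norm (u - xb) < \<rho>' \<Longrightarrow> f x + v \<bullet> (u - x) + \<sigma> / 2 * (norm (u - x))\<^sup>2 \<le> f u"
    using pri.uniform_subgradient_inequality by blast
  have "uniform_subgradients \<Gamma> f xb \<rho> R \<rho>' \<sigma>"
    by unfold_locales (fact \<rho>' \<sigma>)+
  then show ?thesis by blast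
qed

lemma nlp_exists:
  assumes "s \<le> m" "C2_near f xb" "\<forall>i\<in>{1..m}. C2_near (\<phi> i) xb" "MSCQ \<phi> s m xb"
  shows "\<exists>\<delta> c \<kappa>. nlp f \<phi> s m xb \<delta> c \<kappa>"
proof -
  obtain \<delta>1 c1 where 1: "\<delta>1 > 0" "c1 > 0" "C2_bound f xb \<delta>1 c1"
    using C2_near_imp_C2_bound[OF assms(2)] by blast
  obtain \<delta>2 c2 where 2: "\<delta>2 > 0" "c2 > 0" "\<And>i. i \<in> {1..m} \<Longrightarrow> C2_bound (\<phi> i) xb \<delta>2 c2"
    using C2_near_uniform_bound[of "{1..m}" \<phi> xb] assms(3) by auto
  obtain \<kappa> \<delta>3 where 3: "\<kappa> > 0" "\<delta>3 > 0" "\<And>x. x \<in> ball xb \<delta>3 \<Longrightarrow> infdist x (feas \<phi> s m) \<le>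
        \<kappa> * ((\<Sum>i=1..s. max (\<phi> i x) 0) + (\<Sum>i=s+1..m. \<bar>\<phi> i x\<bar>))"
    using assms(4) unfolding MSCQ_def by blast
  define \<delta> where "\<delta> = min \<delta>1 (min \<delta>2 \<delta>3)"
  have \<delta>: "\<delta> \<le> \<delta>1" "\<delta> \<le> \<delta>2" "\<delta> \<le> \<delta>3" "\<delta> > 0" using 1(1) 2(1) 3(2) by (auto simp: \<delta>_def)
  have "nlp f \<phi> s m xb \<delta> (max c1 c2) \<kappa>"
  proof
    show "0 < max c1 c2" using 1(2) by simp
    show "C2_bound f xb \<delta> (max c1 c2)" by (rule C2_bound_mono[OF 1(3) \<delta>(1)]) simp
    show "C2_bound (\<phi> i) xb \<delta> (max c1 c2)" if "i \<in> {1..m}" for i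
      by (rule C2_bound_mono[OF 2(3)[OF that] \<delta>(2)]) simp
    show "infdist x (feas \<phi> s m) \<le> \<kappa> * ((\<Sum>i=1..s. max (\<phi> i x) 0) + (\<Sum>i=s+1..m. \<bar>\<phi> i x\<bar>))"
      if "x \<in> ball xb \<delta>" for x
      by (rule 3(3)) (use that \<delta>(3) in auto)
  qed (fact assms(1) \<delta>(4) 3(1))+
  then show ?thesis by blast
qed

theorem theorem9p3:
  fixes f :: "'a::euclidean_space \<Rightarrow> real"
    and \<phi> :: "nat \<Rightarrow> 'a \<Rightarrow> real"
    and s m :: nat
    and xb :: 'a
    and yb :: "nat \<Rightarrow> real"
  assumes sm: "s \<le> m"
    and f_C2: "C2_near f xb"
    and phi_C2: "\<forall>i\<in>{1..m}. C2_near (\<phi> i) xb"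
    and feasible: "xb \<in> feas \<phi> s m"
    and yb_mult: "yb \<in> mult_cone s"
    and stationary: "grad (\<lambda>z. Lag f \<phi> m z yb) xb = 0"
    and compl: "ypair \<phi> m yb xb = 0"
    and mscq: "MSCQ \<phi> s m xb"
  shows
    "((\<exists>U V. open U \<and> xb \<in> U \<and> open V \<and> 0 \<in> V \<and>
        (\<forall>x\<in>U. \<forall>y\<in>mult_cone s.
           grad (\<lambda>z. Lag f \<phi> m z y) x \<in> V \<and> ypair \<phi> m y x = 0 \<longrightarrow>
           (\<forall>w\<in>Scone \<phi> s m x y.
              hess f x w \<bullet> w + w \<bullet> hess (ypair \<phi> m y) x w \<ge> 0)))
      \<longrightarrow> variationally_convex (Phi f \<phi> s m) xb 0 \<and> local_minimizer (Phi f \<phi> s m) xb)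
   \<and>
    (\<forall>\<sigma>>0. (\<exists>U V. open U \<and> xb \<in> U \<and> open V \<and> 0 \<in> V \<and>
        (\<forall>x\<in>U. \<forall>y\<in>mult_cone s.
           grad (\<lambda>z. Lag f \<phi> m z y) x \<in> V \<and> ypair \<phi> m y x = 0 \<longrightarrow>
           (\<forall>w\<in>Scone \<phi> s m x y.
              hess f x w \<bullet> w + w \<bullet> hess (ypair \<phi> m y) x w \<ge> \<sigma> * (norm w)\<^sup>2)))
      \<longrightarrow> strongly_variationally_convex (Phi f \<phi> s m) xb 0 \<sigma> \<and>
          tilt_stable_min (Phi f \<phi> s m) xb (1 / \<sigma>) \<and>
          strong_local_minimizer (Phi f \<phi> s m) xb)"
proof -
  let ?\<Phi> = "Phi f \<phi> s m"
  obtain \<delta> c \<kappa> where "nlp f \<phi> s m xb \<delta> c \<kappa>" using nlp_exists[OF sm f_C2 phi_C2 mscq] by blast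
  then interpret nlp f \<phi> s m xb \<delta> c \<kappa> .
  have Phi_eq: "?\<Phi> = extension (feas \<phi> s m) f" by (rule ext) (simp add: Phi_def extension_def)
  have crit: "regular_subgradient (feas \<phi> s m) f xb 0"
    by (rule stationary_imp_regular_subgradient[OF feasible yb_mult compl stationary])
  have main: "var_convex_gen (\<lambda>U \<psi>. ereal_strongly_convex_on U \<sigma> \<psi>) ?\<Phi> xb 0 \<and> local_minimizer ?\<Phi> xb \<and>
      (0 < \<sigma> \<longrightarrow> tilt_stable_min ?\<Phi> xb (1 / \<sigma>) \<and> strong_local_minimizer ?\<Phi> xb)"
    if \<sigma>: "0 \<le> \<sigma>" and ex: "\<exists>U V. open U \<and> xb \<in> U \<and> open V \<and> 0 \<in> V \<and>
        (\<forall>x\<in>U. \<forall>y\<in>mult_cone s.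
           grad (\<lambda>z. Lag f \<phi> m z y) x \<in> V \<and> ypair \<phi> m y x = 0 \<longrightarrow>
           (\<forall>w\<in>Scone \<phi> s m x y.
              hess f x w \<bullet> w + w \<bullet> hess (ypair \<phi> m y) x w \<ge> \<sigma> * (norm w)\<^sup>2))" for \<sigma>
  proof -
    obtain U V where UV: "open U" "xb \<in> U" "open V" "0 \<in> V"
      "\<And>x y w. \<lbrakk>x \<in> U; y \<in> mult_cone s; grad (\<lambda>z. Lag f \<phi> m z y) x \<in> V;
        ypair \<phi> m y x = 0; w \<in> Scone \<phi> s m x y\<rbrakk> \<Longrightarrow>
        \<sigma> * (norm w)\<^sup>2 \<le> hess f x w \<bullet> w + w \<bullet> hess (ypair \<phi> m y) x w"
      using ex by blast
    obtain \<rho> \<rho>' where "uniform_subgradients (feas \<phi> s m) f xb \<rho> R \<rho>' \<sigma>"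
      using second_order_imp_uniform_subgradients[OF feasible crit \<sigma> UV] by blast
    then interpret us: uniform_subgradients "feas \<phi> s m" f xb \<rho> R \<rho>' \<sigma> .
    show ?thesis
      unfolding Phi_eq using us.variational_strong_convexity us.local_min us.tilt_stability us.strong_local_min
      by blast
  qed
  \<comment> \<open>Strong convexity of modulus \<open>0\<close> is plain convexity, so (i) is the
    instance \<open>\<sigma> = 0\<close> of \<open>main\<close>.\<close>
  have zero: "(\<lambda>U \<psi>. ereal_strongly_convex_on U 0 \<psi>) = (ereal_convex_on :: 'a set \<Rightarrow> _)"
    by (intro ext) (simp add: ereal_strongly_convex_on_def)
  show ?thesis
    using main[of 0] main
    unfolding variationally_convex_def strongly_variationally_convex_def zero mult_zero_left
    by (auto intro: less_imp_le)
qed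

end
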